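(* Let $\mathcal{C}_N=\mathcal{C}_N(v,\rho)$ be the set of $B=(b_1,\ldots,b_N)\in(\mathbb{R}^d)^N$ with $\sum_{i=1}^N v_i\delta_{b_i}\preceq_C\rho$, and let $\mathcal{B}^N_{\mathrm{Lag}}=\mathcal{B}^N_{\mathrm{Lag}}(v,\rho)$ be the set of vectors of $\rho$-barycenters of Laguerre tessellations with $N$ cells of $\rho$-volumes $v$. Then $$\mathcal{C}_N=\mathrm{conv}\big(\overline{\mathcal{B}^N_{\mathrm{Lag}}}\big).$$ Moreover: (1) $\mathcal{B}^N_{\mathrm{Lag}}$ coincides with the set of exposed points of $\mathcal{C}_N$. (2) The proper exposed faces of $\mathcal{C}_N$ have dimension $d(N-M)$ for $M=2,\ldots,N$. For a given $M$, the exposed faces of dimension $d(N-M)$ are exactly the sets $\mathcal{F}^N_{\mathrm{Lag}}(Y,\sigma)$, where $Y\in(\mathbb{R}^d)^M\setminus\Delta_M$, $\sigma:\{1,\ldots,N\}\to\{1,\ldots,M\}$ is any surjective map, and $$\mathcal{F}^N_{\mathrm{Lag}}(Y,\sigma)=\Big\{B\in(\mathbb{R}^d)^N \;;\; \sum_{i\in\sigma^{-1}(j)}v_i\delta_{b_i}\preceq_C\rho|_{L_j^*(w,Y)}\ \ \forall j=1,\ldots,M\Big\},$$ with $w=(w_1,\ldots,w_M)$, $w_j=\sum_{i\in\sigma^{-1}(j)}v_i$, and $(L_j^*(w,Y))_{j=1}^M$ the unique Laguerre tessellation with generators $Y$ and $\rho$-volumes $w$. (3) The relative boundary of $\mathcal{C}_N$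 is $$\mathrm{rel}\,\partial\mathcal{C}_N=\bigcup_{Y,\sigma}\mathcal{F}^N_{\mathrm{Lag}}(Y,\sigma),$$ where the union is over all $M=2,\ldots,N$, all $Y\in(\mathbb{R}^d)^M\setminus\Delta_M$ and all surjective $\sigma:\{1,\ldots,N\}\to\{1,\ldots,M\}$.
   Context: Let $d,N\ge 1$ be integers. $\mathcal{P}_1(\mathbb{R}^d)$ denotes the Borel probability measures on $\mathbb{R}^d$ with finite first moment. $\rho\in\mathcal{P}_1(\mathbb{R}^d)$ is absolutely continuous with respect to Lebesgue measure with bounded density, and $v=(v_1,\ldots,v_N)\in\mathbb{R}_{>0}^N$ satisfies $\sum_i v_i=1$. Convex order: for finite nonnegative measures $\mu,\nu$ on $\mathbb{R}^d$ with the same total mass and finite first moments, $\mu\preceq_C\nu$ means $\int\varphi\,d\mu\le\int\varphi\,d\nu$ for all convex $\varphi:\mathbb{R}^d\to\mathbb{R}$. For an integer $M\ge 1$, $\Delta_M=\{Y\in(\mathbb{R}^d)^M: y_i=y_j \text{ for some } i<j\}$. Laguerre tessellation: for $Y\in(\mathbb{R}^d)^M\setminus\Delta_M$ (generators) and $\phi\in\mathbb{R}^M$ (weights), the cells are $L_i(\phi,Y)=\{x\in\mathbb{R}^d:\langle x,y_i\rangle-\phi_i\ge\langle x,y_j\rangle-\phi_j\ \forall j\ne i\}$, $i=1,\ldots,M$. For $w\in\mathbb{R}_{>0}^M$ with $\sum_j w_j=1$, there is always a choice of $\phi$ with $\rho(L_j(\phi,Y))=w_j$ for all $j$, and the resulting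 tessellation is unique up to $\rho$-null sets; it is denoted $(L_j^*(w,Y))_{j=1}^M$. $\mathcal{B}^N_{\mathrm{Lag}}(v,\rho)$ is the set of $B\in(\mathbb{R}^d)^N$ for which there is a Laguerre tessellation $(L_i)_{i=1}^N$ with $\rho(L_i)=v_i$ and $b_i=\frac{1}{v_i}\int_{L_i}x\,d\rho(x)$ for all $i$. A face of a convex set $\mathcal C$ is a convex subset containing every closed segment in $\mathcal C$ whose interior intersects it. Exposed faces of $\mathcal{C}_N$ are the sets of maximizers of a linear form on $\mathcal{C}_N$; a (exposed) face is proper if it is neither empty nor all of $\mathcal{C}_N$; exposed points are exposed faces consisting of a single point. The dimension of a convex set is the dimension of its affine hull; relative boundary is taken with respect to the affine hull. *)

theory Defs
  imports "HOL-Probability.Probability"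
begin

definition borel_finite_first_moment :: "('a::euclidean_space) measure \<Rightarrow> bool" where
  "borel_finite_first_moment \<mu> \<longleftrightarrow>
     sets \<mu> = sets borel \<and> finite_measure \<mu> \<and> integrable \<mu> (\<lambda>x. norm x)"

definition P1 :: "('a::euclidean_space) measure set" where
  "P1 = {\<rho>. prob_space \<rho> \<and> borel_finite_first_moment \<rho>}"

definition has_bounded_density :: "('a::euclidean_space) measure \<Rightarrow> bool" where
  "has_bounded_density \<rho> \<longleftrightarrow>
     (\<exists>(f :: 'a \<Rightarrow> real) C. f \<in> borel_measurable borel \<and> (\<forall>x. 0 \<le> f x \<and> f x \<le> C) \<and>
        \<rho> = density lborel (\<lambda>x. ennreal (f x)))"

(* The Bochner integral of a non-integrable function is 0 by convention, whereas a convex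
   function may have integral +infinity against a measure with finite first moment.  Its
   negative part, being dominated by the modulus of an affine function, always has finite integral, so the
   difference below never is infinity - infinity when f is convex. *)
definition ext_integral :: "'a measure \<Rightarrow> ('a \<Rightarrow> real) \<Rightarrow> ereal" where
  "ext_integral \<mu> f =
     enn2ereal (\<integral>\<^sup>+x. ennreal (f x) \<partial>\<mu>) - enn2ereal (\<integral>\<^sup>+x. ennreal (- f x) \<partial>\<mu>)"

definition convex_order :: "('a::euclidean_space) measure \<Rightarrow> 'a measure \<Rightarrow> bool"
    (infix \<open>\<preceq>\<^sub>C\<close> 50) where
  "\<mu> \<preceq>\<^sub>C \<nu> \<longleftrightarrow>
     borel_finite_first_moment \<mu> \<and> borel_finite_first_moment \<nu> \<and>
     measure \<mu> UNIV = measure \<nu> UNIV \<and>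
     (\<forall>\<phi>. convex_on UNIV \<phi> \<longrightarrow> ext_integral \<mu> \<phi> \<le> ext_integral \<nu> \<phi>)"

(* The measure sum_{i in I} v_i delta_{b_i}, as the image under b of the measure on the index
   set I with point masses v_i. *)
definition weighted_diracs ::
    "'i set \<Rightarrow> ('i \<Rightarrow> real) \<Rightarrow> ('i \<Rightarrow> 'a) \<Rightarrow> ('a::euclidean_space) measure" where
  "weighted_diracs I v b = distr (point_measure I (\<lambda>i. ennreal (v i))) borel b"

(* The restriction of a measure to L, still regarded as a measure on the whole space
   (unlike restrict_space). *)
definition measure_restr :: "'a measure \<Rightarrow> 'a set \<Rightarrow> 'a measure" where
  "measure_restr \<rho> L = density \<rho> (indicator L)"

definition laguerre_cell ::
    "'i set \<Rightarrow> ('i \<Rightarrow> real) \<Rightarrow> ('i \<Rightarrow> 'a) \<Rightarrow> 'i \<Rightarrow> ('a::euclidean_space) set" where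
  "laguerre_cell I \<phi> Y i = {x. \<forall>j\<in>I. j \<noteq> i \<longrightarrow> x \<bullet> Y i - \<phi> i \<ge> x \<bullet> Y j - \<phi> j}"

(* For pairwise distinct generators, suitable weights exist and the cells they define are
   unique up to rho-null sets, so it is immaterial which weights are chosen. *)
definition laguerre_star ::
    "('a::euclidean_space) measure \<Rightarrow> 'i set \<Rightarrow> ('i \<Rightarrow> real) \<Rightarrow> ('i \<Rightarrow> 'a) \<Rightarrow> 'i \<Rightarrow> 'a set" where
  "laguerre_star \<rho> I w Y =
     laguerre_cell I (SOME \<phi>. \<forall>j\<in>I. measure \<rho> (laguerre_cell I \<phi> Y j) = w j) Y"

definition C_set :: "real ^ 'n \<Rightarrow> (real ^ 'd) measure \<Rightarrow> ((real ^ 'd) ^ 'n) set" where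
  "C_set v \<rho> = {B. weighted_diracs UNIV (\<lambda>i. v $ i) (\<lambda>i. B $ i) \<preceq>\<^sub>C \<rho>}"

definition B_Lag :: "real ^ 'n \<Rightarrow> (real ^ 'd) measure \<Rightarrow> ((real ^ 'd) ^ 'n) set" where
  "B_Lag v \<rho> =
     {B. \<exists>Y \<phi>. inj Y \<and>
        (\<forall>i. measure \<rho> (laguerre_cell UNIV \<phi> Y i) = v $ i \<and>
             B $ i = (1 / v $ i) *\<^sub>R (LINT x:laguerre_cell UNIV \<phi> Y i|\<rho>. x))}"

(* M-tuples Y are functions on nat of which only the values on {1..M} matter;
   Y lies outside the diagonal Delta_M iff inj_on Y {1..M}. *)
definition F_Lag ::
    "real ^ 'n \<Rightarrow> (real ^ 'd) measure \<Rightarrow> nat \<Rightarrow> (nat \<Rightarrow> real ^ 'd) \<Rightarrow> ('n \<Rightarrow> nat)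
      \<Rightarrow> ((real ^ 'd) ^ 'n) set" where
  "F_Lag v \<rho> M Y \<sigma> =
     {B. \<forall>j\<in>{1..M}.
        weighted_diracs (\<sigma> -` {j}) (\<lambda>i. v $ i) (\<lambda>i. B $ i) \<preceq>\<^sub>C
        measure_restr \<rho> (laguerre_star \<rho> {1..M} (\<lambda>k. \<Sum>i\<in>\<sigma> -` {k}. v $ i) Y j)}"

end

theory Submission
  imports Defs
begin

text \<open>Let \<open>y\<^sub>1, \<dots>, y\<^sub>M\<close> be the distinct values of the generators of a linear form
  \<open>B \<mapsto> \<Sum>\<^sub>i v\<^sub>i \<langle>b\<^sub>i, y\<^bsub>\<sigma>(i)\<^esub>\<rangle>\<close>, and let \<open>u = max\<^sub>j (\<langle>x, y\<^sub>j\<rangle> - \<phi>\<^sub>j)\<close> be the potential whose Laguerre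
  cells have the volumes prescribed by \<open>\<sigma>\<close>; weights \<open>\<phi>\<close> exist because the Kantorovich functional
  has a minimizer. Testing the convex order against \<open>u\<close> bounds the form on the set of dominated
  configurations, and perturbing the \<open>j\<close>-th affine piece of \<open>u\<close> by \<open>\<epsilon> \<psi>\<close> shows that equality
  forces domination on each cell separately. So the exposed faces are exactly the sets \<open>F_Lag\<close>.
  Such a face has the dimension of the affine space cut out by its \<open>M\<close> barycenter constraints,
  since every configuration that satisfies them and is close to the cell barycenters belongs to it.\<close>

section \<open>Convex order and convex functions of linear growth\<close>

text \<open>A convex function need not be integrable against a measure with finite first moment, so
  domination is tested on convex functions of linear growth only. With an atomic measure on the left
  this family is as strong as all convex functions. A form with coefficient vector \<open>a\<close>
  is written with \<open>y_i = a_i / v_i\<close>; coincidences among the \<open>y_i\<close> produce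
  \<open>\<sigma>\<close>, and the number of distinct values fixes the dimension of the face. With a
  single value the form depends only on the barycenter, hence is constant on \<open>C_set\<close>;
  this is why proper faces begin at M = 2. The density acts through the nullity of hyperplanes:
  overlaps of cells are negligible, and no cell carries its mass on a hyperplane, which gives each
  face its full dimension. For the convex hull, forms with repeated generators are the obstacle:
  they need not single out a point of \<open>B_Lag\<close>, so a separating form is moved slightly
  until its generators differ. For the relative boundary, a supporting hyperplane at a boundary
  point that misses the relative interior exposes a proper face.\<close>

definition lin_growth_convex :: "('a::euclidean_space \<Rightarrow> real) \<Rightarrow> bool" where
  "lin_growth_convex \<psi> \<longleftrightarrow> convex_on UNIV \<psi> \<and> (\<exists>A. \<forall>x. \<bar>\<psi> x\<bar> \<le> A * (1 + norm x))"

lemma lin_growth_convexI: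
  assumes "convex_on UNIV \<psi>" "\<And>x. \<bar>\<psi> x\<bar> \<le> A * (1 + norm x)"
  shows "lin_growth_convex \<psi>"
  using assms unfolding lin_growth_convex_def by blast

lemma lin_growth_convex_add:
  assumes "lin_growth_convex f" "lin_growth_convex g"
  shows "lin_growth_convex (\<lambda>x. f x + g x)"
proof -
  obtain A B where "\<And>x. \<bar>f x\<bar> \<le> A * (1 + norm x)" "\<And>x. \<bar>g x\<bar> \<le> B * (1 + norm x)"
    using assms unfolding lin_growth_convex_def by blast
  then have "\<bar>f x + g x\<bar> \<le> (A + B) * (1 + norm x)" for x
    unfolding distrib_right by (metis abs_triangle_ineq add_mono order_trans)
  then show ?thesis
    using assms convex_on_add unfolding lin_growth_convex_def by blast
qed

lemma lin_growth_convex_cmul: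
  assumes "lin_growth_convex f" "0 \<le> c"
  shows "lin_growth_convex (\<lambda>x. c * f x)"
proof -
  obtain A where "\<And>x. \<bar>f x\<bar> \<le> A * (1 + norm x)"
    using assms unfolding lin_growth_convex_def by blast
  then have "\<bar>c * f x\<bar> \<le> (c * A) * (1 + norm x)" for x
    using assms(2) by (simp add: abs_mult mult.assoc mult_left_mono)
  then show ?thesis
    using assms convex_on_cmul unfolding lin_growth_convex_def by blast
qed

lemma lin_growth_convex_max:
  assumes "lin_growth_convex f" "lin_growth_convex g"
  shows "lin_growth_convex (\<lambda>x. max (f x) (g x))"
proof -
  obtain A B where AB: "\<And>x. \<bar>f x\<bar> \<le> A * (1 + norm x)" "\<And>x. \<bar>g x\<bar> \<le> B * (1 + norm x)"
    using assms unfolding lin_growth_convex_def by blast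
  have "A * (1 + norm x) \<le> max A B * (1 + norm x)" "B * (1 + norm x) \<le> max A B * (1 + norm x)" for x :: 'a
    by (auto intro!: mult_right_mono)
  with AB have bound: "\<bar>max (f x) (g x)\<bar> \<le> max A B * (1 + norm x)" for x
    by (smt (verit))
  have conv: "convex_on UNIV (\<lambda>x. max (f x) (g x))"
  proof
    fix t :: real and x y
    assume t: "t > 0" "t < 1"
    have "f ((1 - t) *\<^sub>R x + t *\<^sub>R y) \<le> (1 - t) * f x + t * f y"
      "g ((1 - t) *\<^sub>R x + t *\<^sub>R y) \<le> (1 - t) * g x + t * g y"
      using assms t unfolding lin_growth_convex_def convex_on_def by auto
    moreover have "(1 - t) * f x \<le> (1 - t) * max (f x) (g x)" "t * f y \<le> t * max (f y) (g y)"
      "(1 - t) * g x \<le> (1 - t) * max (f x) (g x)" "t * g y \<le> t * max (f y) (g y)"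
      using t by (auto intro!: mult_left_mono)
    ultimately show "max (f ((1 - t) *\<^sub>R x + t *\<^sub>R y)) (g ((1 - t) *\<^sub>R x + t *\<^sub>R y))
        \<le> (1 - t) * max (f x) (g x) + t * max (f y) (g y)"
      by linarith
  qed auto
  show ?thesis
    using lin_growth_convexI[OF conv bound] .
qed

lemma lin_growth_convex_Max:
  assumes "finite J" "J \<noteq> {}" "\<And>j. j \<in> J \<Longrightarrow> lin_growth_convex (f j)"
  shows "lin_growth_convex (\<lambda>x. MAX j\<in>J. f j x)"
  using assms
proof (induction J rule: finite_ne_induct)
  case (insert j J)
  then show ?case
    using lin_growth_convex_max[of "f j" "\<lambda>x. MAX j\<in>J. f j x"] by simp
qed simp

lemma lin_growth_convex_affine:
  fixes p :: "'a::euclidean_space"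
  shows "lin_growth_convex (\<lambda>x. x \<bullet> p + c)"
proof (rule lin_growth_convexI)
  show "convex_on UNIV (\<lambda>x. x \<bullet> p + c)"
    unfolding convex_on_def
  proof (intro conjI ballI allI impI)
    fix x y :: 'a and u w :: real
    assume "u + w = 1"
    then have "c = u * c + w * c"
      by (metis distrib_right mult_1)
    then show "(u *\<^sub>R x + w *\<^sub>R y) \<bullet> p + c \<le> u * (x \<bullet> p + c) + w * (y \<bullet> p + c)"
      by (simp add: inner_add_left algebra_simps)
  qed simp
  show "\<bar>x \<bullet> p + c\<bar> \<le> (norm p + \<bar>c\<bar>) * (1 + norm x)" for x
  proof -
    have "\<bar>x \<bullet> p\<bar> \<le> norm x * norm p" "0 \<le> norm p" "0 \<le> \<bar>c\<bar> * norm x"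
      by (auto simp: Cauchy_Schwarz_ineq2)
    then show ?thesis
      using abs_triangle_ineq[of "x \<bullet> p" c] unfolding distrib_left distrib_right mult_1_right
      by (simp only: mult.commute[of "norm p"])
  qed
qed

lemma lin_growth_convex_measurable:
  assumes "lin_growth_convex \<psi>"
  shows "\<psi> \<in> borel_measurable borel"
  using assms convex_on_continuous[of UNIV \<psi>] borel_measurable_continuous_onI
  unfolding lin_growth_convex_def by blast

text \<open>A hyperplane separating \<open>(a, \<psi> a)\<close> from the strict epigraph is the
  graph of the tangent. It cannot be vertical because \<open>\<psi>\<close> is finite on the whole
  space.\<close>

lemma convex_on_subgradient:
  fixes \<psi> :: "'a::euclidean_space \<Rightarrow> real"
  assumes "convex_on UNIV \<psi>"
  obtains p where "\<And>x. \<psi> a + (x - a) \<bullet> p \<le> \<psi> x"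
proof -
  define S where "S = {z::'a \<times> real. \<psi> (fst z) < snd z}"
  have "convex S"
    unfolding convex_alt
  proof safe
    fix x s y t and u :: real
    assume S: "(x, s) \<in> S" "(y, t) \<in> S" and u: "0 \<le> u" "u \<le> 1"
    have "\<psi> ((1 - u) *\<^sub>R x + u *\<^sub>R y) \<le> (1 - u) * \<psi> x + u * \<psi> y"
      using assms u unfolding convex_on_def by auto
    also have "\<dots> < (1 - u) * s + u * t"
    proof (cases "u = 0")
      case False
      then have "u * \<psi> y < u * t" "(1 - u) * \<psi> x \<le> (1 - u) * s"
        using S u by (auto simp: S_def intro!: mult_left_mono)
      then show ?thesis by simp
    qed (use S in \<open>simp add: S_def\<close>)
    finally show "(1 - u) *\<^sub>R (x, s) + u *\<^sub>R (y, t) \<in> S"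
      by (simp add: S_def)
  qed
  moreover have "(a, \<psi> a + 1) \<in> S" "{(a, \<psi> a)} \<inter> S = {}"
    by (auto simp: S_def)
  ultimately obtain n b where "n \<noteq> 0" "n \<bullet> (a, \<psi> a) \<le> b" "\<forall>z\<in>S. b \<le> n \<bullet> z"
    using separating_hyperplane_sets[of "{(a, \<psi> a)}" S] by fastforce
  then obtain q s where n: "(q, s) \<noteq> 0" and le: "\<And>x t. \<psi> x < t \<Longrightarrow> q \<bullet> a + s * \<psi> a \<le> q \<bullet> x + s * t"
    by (cases n) (force simp: S_def)
  have "s \<ge> 0"
    using le[of a "\<psi> a + 1"] by (simp add: algebra_simps)
  \<comment> \<open>With \<open>s = 0\<close> the separation would bound the nonzero functional
    \<open>q\<close> from below on the whole space; the point \<open>a - q\<close> refutes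
    this.\<close>
  moreover have "s \<noteq> 0"
  proof
    assume s: "s = 0"
    have "q \<bullet> a \<le> q \<bullet> (a - q)"
      using le[of "a - q" "\<psi> (a - q) + 1"] s by simp
    then have "q \<bullet> q \<le> 0"
      by (simp add: inner_diff_right)
    then show False
      using n s inner_ge_zero[of q] by (simp add: zero_prod_def order_antisym_conv)
  qed
  ultimately have s: "s > 0" by simp
  have "\<psi> a + (x - a) \<bullet> (- (1 / s) *\<^sub>R q) \<le> \<psi> x" for x
  \<comment> \<open>The epigraph is strict, so the separation holds for heights \<open>t\<close>
    above \<open>\<psi> x\<close> and the value \<open>\<psi> x\<close> itself is reached as an
    infimum.\<close>
  proof (rule dense_ge)
    fix t assume "\<psi> x < t"
    then show "\<psi> a + (x - a) \<bullet> (- (1 / s) *\<^sub>R q) \<le> t"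
      using le[of x t] s by (simp add: field_simps inner_diff_right inner_commute)
  qed
  then show thesis
    using that by blast
qed

lemma lin_growth_convex_subgradient:
  assumes "lin_growth_convex \<psi>"
  obtains p where "\<And>x. \<psi> a + (x - a) \<bullet> p \<le> \<psi> x"
  using assms convex_on_subgradient unfolding lin_growth_convex_def by blast

section \<open>Measures with finite first moment and finite atomic measures\<close>

locale first_moment_measure = finite_measure \<mu> for \<mu> :: "'a::euclidean_space measure" +
  assumes sets_eq [simp, measurable_cong]: "sets \<mu> = sets borel"
    and integrable_norm: "integrable \<mu> (\<lambda>x. norm x)"

lemma borel_finite_first_moment_iff:
  "borel_finite_first_moment \<mu> \<longleftrightarrow> first_moment_measure \<mu>"
  unfolding borel_finite_first_moment_def first_moment_measure_def first_moment_measure_axioms_def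
  by auto

lemma ext_integral_integrable:
  assumes "integrable \<mu> f"
  shows "ext_integral \<mu> f = ereal (\<integral>x. f x \<partial>\<mu>)"
proof -
  have "(\<integral>\<^sup>+x. ennreal (f x) \<partial>\<mu>) \<noteq> \<infinity>" "(\<integral>\<^sup>+x. ennreal (- f x) \<partial>\<mu>) \<noteq> \<infinity>"
    using assms real_integrable_def by auto
  then have "enn2ereal (\<integral>\<^sup>+x. ennreal (f x) \<partial>\<mu>) = ereal (enn2real (\<integral>\<^sup>+x. ennreal (f x) \<partial>\<mu>))"
    "enn2ereal (\<integral>\<^sup>+x. ennreal (- f x) \<partial>\<mu>) = ereal (enn2real (\<integral>\<^sup>+x. ennreal (- f x) \<partial>\<mu>))"
    by (simp_all add: less_top flip: enn2ereal_ennreal)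
  then show ?thesis
    unfolding ext_integral_def real_lebesgue_integral_def[OF assms] by simp
qed

lemma ext_integral_mono:
  assumes "\<And>x. f x \<le> g x"
  shows "ext_integral \<mu> f \<le> ext_integral \<mu> g"
  unfolding ext_integral_def
  by (intro ereal_minus_mono) (auto intro!: nn_integral_mono ennreal_leI assms simp: less_eq_ennreal.rep_eq[symmetric])

context first_moment_measure
begin

lemma space_eq [simp]: "space \<mu> = UNIV"
  using sets_eq_imp_space_eq[OF sets_eq] by simp

lemma integrable_lin_growth:
  fixes f :: "'a \<Rightarrow> 'b::euclidean_space"
  assumes "f \<in> borel_measurable borel" "\<And>x. norm (f x) \<le> A * (1 + norm x)"
  shows "integrable \<mu> f"
proof (rule Bochner_Integration.integrable_bound)
  show "integrable \<mu> (\<lambda>x. A * (1 + norm x))"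
    by (intro integrable_mult_right Bochner_Integration.integrable_add integrable_norm) simp
  show "f \<in> borel_measurable \<mu>"
    using assms(1) by simp
  show "AE x in \<mu>. norm (f x) \<le> norm (A * (1 + norm x))"
    using assms(2) by (auto intro: order_trans abs_ge_self)
qed

lemma integrable_lin_growth_convex:
  assumes "lin_growth_convex \<psi>"
  shows "integrable \<mu> \<psi>"
  using assms integrable_lin_growth[OF lin_growth_convex_measurable[OF assms]]
  unfolding lin_growth_convex_def real_norm_def by blast

lemma integrable_ident: "integrable \<mu> (\<lambda>x. x)"
  by (rule integrable_lin_growth[where A=1]) auto

end

lemma integrable_weighted_diracs:
  assumes "finite I" "f \<in> borel_measurable borel"
  shows "integrable (weighted_diracs I v b) (f :: _ \<Rightarrow> real)"
  unfolding weighted_diracs_def using assms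
  by (subst integrable_distr_eq) (auto intro: integrable_point_measure_finite)

lemma integral_weighted_diracs:
  assumes "finite I" "\<And>i. i \<in> I \<Longrightarrow> 0 \<le> v i" "f \<in> borel_measurable borel"
  shows "(\<integral>x. f x \<partial>weighted_diracs I v b) = (\<Sum>i\<in>I. v i * f (b i) :: real)"
  unfolding weighted_diracs_def using assms
  by (subst integral_distr) (auto simp: lebesgue_integral_point_measure_finite)

lemma first_moment_measure_weighted_diracs:
  assumes "finite I"
  shows "first_moment_measure (weighted_diracs I v b)"
proof -
  have "emeasure (weighted_diracs I v b) UNIV = emeasure (point_measure I (\<lambda>i. ennreal (v i))) I"
    unfolding weighted_diracs_def by (subst emeasure_distr) (auto simp: space_point_measure)
  also have "\<dots> = (\<Sum>i\<in>I. ennreal (v i))"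
    using assms by (subst emeasure_point_measure_finite) auto
  also have "\<dots> \<noteq> \<infinity>"
    using assms by simp
  finally have "emeasure (weighted_diracs I v b) (space (weighted_diracs I v b)) \<noteq> \<infinity>"
    by (simp add: weighted_diracs_def)
  moreover have "sets (weighted_diracs I v b) = sets borel"
    by (simp add: weighted_diracs_def)
  moreover have "integrable (weighted_diracs I v b) norm"
    using assms by (rule integrable_weighted_diracs) simp
  ultimately show ?thesis
    by (simp add: first_moment_measure_def first_moment_measure_axioms_def finite_measureI)
qed

text \<open>Convex order with an atomic left side, in terms of ordinary real integrals. Equality of
  masses and of barycenters is not listed, because affine test functions already force it.\<close>

definition dominated_by :: "'i set \<Rightarrow> ('i \<Rightarrow> real) \<Rightarrow> ('i \<Rightarrow> 'a::euclidean_space) \<Rightarrow> 'a measure \<Rightarrow> bool" where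
  "dominated_by I v b \<mu> \<longleftrightarrow>
    (\<forall>\<psi>. lin_growth_convex \<psi> \<longrightarrow> (\<Sum>i\<in>I. v i * \<psi> (b i)) \<le> (\<integral>x. \<psi> x \<partial>\<mu>))"

lemma dominated_byD:
  "dominated_by I v b \<mu> \<Longrightarrow> lin_growth_convex \<psi> \<Longrightarrow> (\<Sum>i\<in>I. v i * \<psi> (b i)) \<le> (\<integral>x. \<psi> x \<partial>\<mu>)"
  unfolding dominated_by_def by blast

context first_moment_measure
begin

text \<open>An affine function and its negative are both admissible tests, so the inequality holds
  in both directions.\<close>

lemma dominated_by_affine_eq:
  assumes "dominated_by I v b \<mu>"
  shows "(\<Sum>i\<in>I. v i * (b i \<bullet> p + c)) = (\<integral>x. x \<bullet> p + c \<partial>\<mu>)"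
proof (rule antisym)
  show "(\<Sum>i\<in>I. v i * (b i \<bullet> p + c)) \<le> (\<integral>x. x \<bullet> p + c \<partial>\<mu>)"
    using assms lin_growth_convex_affine by (rule dominated_byD)
  have "(\<Sum>i\<in>I. v i * (b i \<bullet> (- p) + (- c))) \<le> (\<integral>x. x \<bullet> (- p) + (- c) \<partial>\<mu>)"
    using assms lin_growth_convex_affine by (rule dominated_byD)
  moreover have "(\<Sum>i\<in>I. v i * (b i \<bullet> (- p) + (- c))) = - (\<Sum>i\<in>I. v i * (b i \<bullet> p + c))"
    unfolding sum_negf[symmetric] by (simp add: algebra_simps)
  moreover have "(\<integral>x. x \<bullet> (- p) + (- c) \<partial>\<mu>) = - (\<integral>x. x \<bullet> p + c \<partial>\<mu>)"
    unfolding integral_minus[symmetric] by (simp add: algebra_simps)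
  ultimately show "(\<integral>x. x \<bullet> p + c \<partial>\<mu>) \<le> (\<Sum>i\<in>I. v i * (b i \<bullet> p + c))"
    by simp
qed

lemma dominated_by_mass:
  assumes "dominated_by I v b \<mu>"
  shows "(\<Sum>i\<in>I. v i) = measure \<mu> UNIV"
  using dominated_by_affine_eq[OF assms, of 0 1] by simp

lemma dominated_by_barycenter:
  assumes "dominated_by I v b \<mu>"
  shows "(\<Sum>i\<in>I. v i *\<^sub>R b i) = (\<integral>x. x \<partial>\<mu>)"
proof (rule euclidean_eqI)
  fix e :: 'a
  show "(\<Sum>i\<in>I. v i *\<^sub>R b i) \<bullet> e = (\<integral>x. x \<partial>\<mu>) \<bullet> e"
    using dominated_by_affine_eq[OF assms, of e 0] integrable_ident
    by (simp add: inner_sum_left)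
qed

text \<open>A convex function can be replaced by the maximum of finitely many of its tangents,
  one at each atom, so that integrability against \<open>\<mu>\<close> is no issue.\<close>

lemma weighted_diracs_convex_order_iff:
  assumes I: "finite I" and v: "\<And>i. i \<in> I \<Longrightarrow> 0 \<le> v i"
  shows "weighted_diracs I v b \<preceq>\<^sub>C \<mu> \<longleftrightarrow> dominated_by I v b \<mu>"
proof
  assume *: "weighted_diracs I v b \<preceq>\<^sub>C \<mu>"
  show "dominated_by I v b \<mu>"
    unfolding dominated_by_def
  proof safe
    fix \<psi> :: "'a \<Rightarrow> real" assume \<psi>: "lin_growth_convex \<psi>"
    then have "ext_integral (weighted_diracs I v b) \<psi> \<le> ext_integral \<mu> \<psi>"
      using * unfolding convex_order_def lin_growth_convex_def by blast
    then show "(\<Sum>i\<in>I. v i * \<psi> (b i)) \<le> (\<integral>x. \<psi> x \<partial>\<mu>)"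
      using \<psi> I v
      by (simp add: ext_integral_integrable integrable_weighted_diracs integral_weighted_diracs
          lin_growth_convex_measurable integrable_lin_growth_convex)
  qed
next
  assume dom: "dominated_by I v b \<mu>"
  show "weighted_diracs I v b \<preceq>\<^sub>C \<mu>"
    unfolding convex_order_def borel_finite_first_moment_iff
  proof (intro conjI allI impI)
    show "first_moment_measure (weighted_diracs I v b)"
      using I by (rule first_moment_measure_weighted_diracs)
    show "first_moment_measure \<mu>" ..
    interpret wd: first_moment_measure "weighted_diracs I v b"
      using I by (rule first_moment_measure_weighted_diracs)
    show "measure (weighted_diracs I v b) UNIV = measure \<mu> UNIV"
      using integral_weighted_diracs[where f="\<lambda>_. 1" and b=b and v=v, OF I v] dominated_by_mass[OF dom]
      by simp
  next
    fix \<phi> :: "'a \<Rightarrow> real" assume \<phi>: "convex_on UNIV \<phi>"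
    \<comment> \<open>The point 0 keeps the maximum defined when \<open>I\<close> is empty; its
      tangent lies below \<open>\<phi>\<close> like the others.\<close>
    define K where "K = insert 0 (b ` I)"
    have K: "finite K" "K \<noteq> {}"
      using I by (auto simp: K_def)
    have "\<exists>p. \<forall>x. \<phi> a + (x - a) \<bullet> p \<le> \<phi> x" for a
      using convex_on_subgradient[OF \<phi>] by metis
    then obtain p where p: "\<And>a x. \<phi> a + (x - a) \<bullet> p a \<le> \<phi> x"
      by metis
    define \<psi> where "\<psi> x = (MAX a\<in>K. \<phi> a + (x - a) \<bullet> p a)" for x
    have \<psi>: "lin_growth_convex \<psi>"
      unfolding \<psi>_def
    proof (rule lin_growth_convex_Max[OF K])
      show "lin_growth_convex (\<lambda>x. \<phi> a + (x - a) \<bullet> p a)" for a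
        using lin_growth_convex_affine[of "p a" "\<phi> a - a \<bullet> p a"]
        by (simp add: inner_diff_left algebra_simps)
    qed
    have le: "\<psi> x \<le> \<phi> x" for x
      unfolding \<psi>_def using K p by simp
    have eq: "\<psi> (b i) = \<phi> (b i)" if "i \<in> I" for i
    proof (rule antisym[OF le])
      have "\<phi> (b i) + (b i - b i) \<bullet> p (b i) \<le> \<psi> (b i)"
        unfolding \<psi>_def using K that
        by (intro Max_ge rev_image_eqI[of "b i"]) (auto simp: K_def)
      then show "\<phi> (b i) \<le> \<psi> (b i)"
        by simp
    qed
    have meas: "\<phi> \<in> borel_measurable borel"
      using \<phi> by (intro borel_measurable_continuous_onI convex_on_continuous) auto
    have "ext_integral (weighted_diracs I v b) \<phi> = ereal (\<Sum>i\<in>I. v i * \<phi> (b i))"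
      using I v meas
      by (simp add: ext_integral_integrable integrable_weighted_diracs integral_weighted_diracs)
    also have "\<dots> = ereal (\<Sum>i\<in>I. v i * \<psi> (b i))"
      using eq by simp
    also have "\<dots> \<le> ereal (\<integral>x. \<psi> x \<partial>\<mu>)"
      using dominated_byD[OF dom \<psi>] by simp
    also have "\<dots> = ext_integral \<mu> \<psi>"
      using \<psi> by (simp add: ext_integral_integrable integrable_lin_growth_convex)
    also have "\<dots> \<le> ext_integral \<mu> \<phi>"
      using le by (rule ext_integral_mono)
    finally show "ext_integral (weighted_diracs I v b) \<phi> \<le> ext_integral \<mu> \<phi>" .
  qed
qed

end

section \<open>Laguerre cells and their weights\<close>

definition laguerre_potential ::
    "'i set \<Rightarrow> ('i \<Rightarrow> real) \<Rightarrow> ('i \<Rightarrow> 'a) \<Rightarrow> ('a::euclidean_space) \<Rightarrow> real" where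
  "laguerre_potential J \<phi> Y x = (MAX j\<in>J. x \<bullet> Y j - \<phi> j)"

lemma mem_laguerre_cell:
  "x \<in> laguerre_cell J \<phi> Y i \<longleftrightarrow> (\<forall>j\<in>J. x \<bullet> Y j - \<phi> j \<le> x \<bullet> Y i - \<phi> i)"
  unfolding laguerre_cell_def by auto

lemma laguerre_cell_less:
  assumes "x \<in> laguerre_cell J \<phi> Y j" "x \<notin> laguerre_cell J \<phi> Y k"
  shows "x \<bullet> Y k - \<phi> k < x \<bullet> Y j - \<phi> j"
  using assms by (auto simp: mem_laguerre_cell not_le intro: less_le_trans)

lemma closed_laguerre_cell: "closed (laguerre_cell J \<phi> Y i)"
proof -
  have "laguerre_cell J \<phi> Y i = (\<Inter>j\<in>J. {x. x \<bullet> Y j - \<phi> j \<le> x \<bullet> Y i - \<phi> i})"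
    by (auto simp: mem_laguerre_cell)
  then show ?thesis
    by (auto intro!: closed_INT closed_Collect_le continuous_intros)
qed

lemma laguerre_cell_borel [measurable]: "laguerre_cell J \<phi> Y i \<in> sets borel"
  by (simp add: closed_laguerre_cell borel_closed)

lemma laguerre_potential_ge:
  "finite J \<Longrightarrow> j \<in> J \<Longrightarrow> x \<bullet> Y j - \<phi> j \<le> laguerre_potential J \<phi> Y x"
  unfolding laguerre_potential_def by simp

lemma laguerre_potential_le_iff:
  "finite J \<Longrightarrow> J \<noteq> {} \<Longrightarrow> laguerre_potential J \<phi> Y x \<le> c \<longleftrightarrow> (\<forall>j\<in>J. x \<bullet> Y j - \<phi> j \<le> c)"
  unfolding laguerre_potential_def by simp

lemma laguerre_potential_on_cell:
  assumes "finite J" "j \<in> J" "x \<in> laguerre_cell J \<phi> Y j"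
  shows "laguerre_potential J \<phi> Y x = x \<bullet> Y j - \<phi> j"
proof (rule antisym[OF _ laguerre_potential_ge[OF assms(1,2)]])
  have "J \<noteq> {}" using assms(2) by auto
  then show "laguerre_potential J \<phi> Y x \<le> x \<bullet> Y j - \<phi> j"
    using assms by (simp add: laguerre_potential_le_iff mem_laguerre_cell)
qed

lemma laguerre_cells_cover:
  assumes "finite J" "J \<noteq> {}"
  obtains j where "j \<in> J" "x \<in> laguerre_cell J \<phi> Y j"
proof -
  have "laguerre_potential J \<phi> Y x \<in> (\<lambda>j. x \<bullet> Y j - \<phi> j) ` J"
    unfolding laguerre_potential_def using assms by (intro Max_in) auto
  then obtain j where j: "j \<in> J" "laguerre_potential J \<phi> Y x = x \<bullet> Y j - \<phi> j"
    by blast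
  have "x \<in> laguerre_cell J \<phi> Y j"
    unfolding mem_laguerre_cell using laguerre_potential_ge[OF assms(1), of _ x Y \<phi>] j by simp
  with j(1) show thesis
    by (rule that)
qed

lemma lin_growth_convex_laguerre_potential:
  assumes "finite J" "J \<noteq> {}"
  shows "lin_growth_convex (laguerre_potential J \<phi> Y)"
proof -
  have "lin_growth_convex (\<lambda>x. MAX j\<in>J. x \<bullet> Y j + (- \<phi> j))"
    using assms lin_growth_convex_affine by (intro lin_growth_convex_Max)
  then show ?thesis
    by (simp add: laguerre_potential_def[abs_def])
qed

section \<open>Measures that do not charge hyperplanes\<close>

locale hyperplane_null_measure = first_moment_measure +
  assumes hyperplane_null: "a \<noteq> 0 \<Longrightarrow> {x. x \<bullet> a = c} \<in> null_sets \<mu>"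
begin

text \<open>A common point of the cells \<open>j\<close> and \<open>k\<close> satisfies
  \<open>x \<bullet> (Y j - Y k) = \<phi> j - \<phi> k\<close>, which is a hyperplane since the
  generators differ.\<close>

lemma AE_not_in_two_cells:
  assumes "finite J" "inj_on Y J"
  shows "AE x in \<mu>. \<forall>j\<in>J. \<forall>k\<in>J. j \<noteq> k \<longrightarrow>
    \<not> (x \<in> laguerre_cell J \<phi> Y j \<and> x \<in> laguerre_cell J \<phi> Y k)"
proof (intro AE_finite_allI[OF assms(1)])
  fix j k assume jk: "j \<in> J" "k \<in> J"
  show "AE x in \<mu>. j \<noteq> k \<longrightarrow> \<not> (x \<in> laguerre_cell J \<phi> Y j \<and> x \<in> laguerre_cell J \<phi> Y k)"
  proof (cases "j = k")
    case False
    then have "Y j - Y k \<noteq> 0"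
      using assms(2) jk by (auto simp: inj_on_def)
    then have "AE x in \<mu>. x \<notin> {x. x \<bullet> (Y j - Y k) = \<phi> j - \<phi> k}"
      by (intro AE_not_in hyperplane_null)
    then show ?thesis
      by eventually_elim (use jk in \<open>force simp: mem_laguerre_cell inner_diff_right\<close>)
  qed simp
qed

lemma AE_sum_indicator_cells:
  assumes "finite J" "J \<noteq> {}" "inj_on Y J"
  shows "AE x in \<mu>. (\<Sum>j\<in>J. indicator (laguerre_cell J \<phi> Y j) x) = (1::real)"
  using AE_not_in_two_cells[OF assms(1,3), of \<phi>]
proof eventually_elim
  case (elim x)
  obtain k where k: "k \<in> J" "x \<in> laguerre_cell J \<phi> Y k"
    using laguerre_cells_cover assms by metis
  then have "(\<Sum>j\<in>J. indicator (laguerre_cell J \<phi> Y j) x) = (\<Sum>j\<in>J. if j = k then 1 else (0::real))"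
    using elim by (intro sum.cong) (auto simp: indicator_def)
  then show ?case
    using k assms by simp
qed

lemma integral_split_cells:
  fixes f :: "'a \<Rightarrow> 'b::euclidean_space"
  assumes "finite J" "J \<noteq> {}" "inj_on Y J" and f: "integrable \<mu> f"
  shows "(\<Sum>j\<in>J. LINT x:laguerre_cell J \<phi> Y j|\<mu>. f x) = (\<integral>x. f x \<partial>\<mu>)"
proof -
  have "(\<Sum>j\<in>J. LINT x:laguerre_cell J \<phi> Y j|\<mu>. f x)
      = (\<integral>x. (\<Sum>j\<in>J. indicator (laguerre_cell J \<phi> Y j) x *\<^sub>R f x) \<partial>\<mu>)"
    unfolding set_lebesgue_integral_def using f
    by (intro Bochner_Integration.integral_sum[symmetric] integrable_mult_indicator) auto
  also have "\<dots> = (\<integral>x. f x \<partial>\<mu>)"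
  proof (rule integral_cong_AE)
    show "AE x in \<mu>. (\<Sum>j\<in>J. indicator (laguerre_cell J \<phi> Y j) x *\<^sub>R f x) = f x"
      using AE_sum_indicator_cells[OF assms(1-3), of \<phi>]
      by eventually_elim (simp flip: scaleR_left.sum)
  qed (use f in \<open>auto intro!: borel_measurable_sum borel_measurable_scaleR\<close>)
  finally show ?thesis .
qed

lemma sum_measure_cells:
  assumes "finite J" "J \<noteq> {}" "inj_on Y J"
  shows "(\<Sum>j\<in>J. measure \<mu> (laguerre_cell J \<phi> Y j)) = measure \<mu> UNIV"
  using integral_split_cells[OF assms, of "\<lambda>_. 1::real"]
  by (simp add: set_lebesgue_integral_def del: integral_const)

end

lemma (in first_moment_measure) measure_restr:
  fixes f :: "'a \<Rightarrow> 'b::euclidean_space"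
  assumes "A \<in> sets borel"
  shows first_moment_measure_restr: "first_moment_measure (measure_restr \<mu> A)"
    and integral_measure_restr:
      "f \<in> borel_measurable borel \<Longrightarrow> (\<integral>x. f x \<partial>measure_restr \<mu> A) = (LINT x:A|\<mu>. f x)"
    and measure_measure_restr: "measure (measure_restr \<mu> A) UNIV = measure \<mu> A"
proof -
  have *: "measure_restr \<mu> A = density \<mu> (\<lambda>x. ennreal (indicator A x))"
    unfolding measure_restr_def by (simp add: ennreal_indicator)
  have A: "A \<in> sets \<mu>" using assms by simp
  have em: "emeasure (measure_restr \<mu> A) UNIV = emeasure \<mu> A"
    unfolding measure_restr_def using A by (subst emeasure_density) auto
  show "first_moment_measure (measure_restr \<mu> A)"
    unfolding first_moment_measure_def first_moment_measure_axioms_def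
  proof (intro conjI finite_measureI)
    show "emeasure (measure_restr \<mu> A) (space (measure_restr \<mu> A)) \<noteq> \<infinity>"
      using em by (simp add: measure_restr_def)
    show "sets (measure_restr \<mu> A) = sets borel"
      by (simp add: measure_restr_def)
    show "integrable (measure_restr \<mu> A) norm"
      unfolding * using A integrable_norm
      by (subst integrable_density) (auto intro!: integrable_mult_indicator[where f=norm, simplified])
  qed
  show "f \<in> borel_measurable borel \<Longrightarrow> (\<integral>x. f x \<partial>measure_restr \<mu> A) = (LINT x:A|\<mu>. f x)"
    unfolding * set_lebesgue_integral_def using A by (subst integral_density) auto
  show "measure (measure_restr \<mu> A) UNIV = measure \<mu> A"
    using em by (simp add: measure_def)
qed

text \<open>Allows the analysis near the barycenter to be carried out separately on each
  cell.\<close>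

lemma (in hyperplane_null_measure) hyperplane_null_measure_restr:
  assumes "A \<in> sets borel"
  shows "hyperplane_null_measure (measure_restr \<mu> A)"
proof -
  have "absolutely_continuous \<mu> (measure_restr \<mu> A)"
    unfolding measure_restr_def using assms by (intro absolutely_continuousI_density) auto
  then show ?thesis
    using first_moment_measure_restr[OF assms] hyperplane_null
    by (auto simp: hyperplane_null_measure_def hyperplane_null_measure_axioms_def
        absolutely_continuous_def)
qed

text \<open>The weights are a minimizer of the Kantorovich functional
  \<open>\<phi> \<mapsto> \<integral> max\<^sub>j (\<langle>x, y\<^sub>j\<rangle> - \<phi>\<^sub>j) d\<mu> + \<Sum>\<^sub>j w\<^sub>j \<phi>\<^sub>j\<close>. It is invariant under adding constants to
  \<open>\<phi>\<close>, so only \<open>\<phi> \<ge> 0\<close> vanishing somewhere matter, and on these it is coercive.\<close>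

definition kantorovich_functional ::
    "('a::euclidean_space) measure \<Rightarrow> 'i set \<Rightarrow> ('i \<Rightarrow> real) \<Rightarrow> ('i \<Rightarrow> 'a) \<Rightarrow> ('i \<Rightarrow> real) \<Rightarrow> real" where
  "kantorovich_functional \<mu> J w Y \<phi> =
    (\<integral>x. laguerre_potential J \<phi> Y x \<partial>\<mu>) + (\<Sum>j\<in>J. w j * \<phi> j)"

context first_moment_measure
begin

lemma integrable_laguerre_potential:
  "finite J \<Longrightarrow> J \<noteq> {} \<Longrightarrow> integrable \<mu> (laguerre_potential J \<phi> Y)"
  by (intro integrable_lin_growth_convex lin_growth_convex_laguerre_potential)

text \<open>Bounding by a sum over the coordinates in \<open>J\<close>, and not by a norm, suits the
  product topology on functions: continuity then follows from continuity of evaluation at each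
  index.\<close>

lemma kantorovich_functional_lipschitz:
  assumes J: "finite J" "J \<noteq> {}"
  shows "kantorovich_functional \<mu> J w Y \<phi> \<le> kantorovich_functional \<mu> J w Y \<phi>'
    + (\<Sum>j\<in>J. (measure \<mu> UNIV + \<bar>w j\<bar>) * \<bar>\<phi> j - \<phi>' j\<bar>)"
proof -
  define D where "D = (\<Sum>j\<in>J. \<bar>\<phi> j - \<phi>' j\<bar>)"
  have "laguerre_potential J \<phi> Y x \<le> laguerre_potential J \<phi>' Y x + D" for x
    unfolding laguerre_potential_le_iff[OF J]
  proof
    fix j assume j: "j \<in> J"
    then have "\<bar>\<phi> j - \<phi>' j\<bar> \<le> D"
      unfolding D_def using J by (intro member_le_sum) auto
    then show "x \<bullet> Y j - \<phi> j \<le> laguerre_potential J \<phi>' Y x + D"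
      using laguerre_potential_ge[OF J(1) j, where x=x and Y=Y and \<phi>=\<phi>'] by linarith
  qed
  then have "(\<integral>x. laguerre_potential J \<phi> Y x \<partial>\<mu>) \<le> (\<integral>x. laguerre_potential J \<phi>' Y x + D \<partial>\<mu>)"
    using integrable_laguerre_potential[OF J] by (intro integral_mono) auto
  also have "\<dots> = (\<integral>x. laguerre_potential J \<phi>' Y x \<partial>\<mu>) + measure \<mu> UNIV * D"
    using integrable_laguerre_potential[OF J] by simp
  finally have "(\<integral>x. laguerre_potential J \<phi> Y x \<partial>\<mu>)
      \<le> (\<integral>x. laguerre_potential J \<phi>' Y x \<partial>\<mu>) + (\<Sum>j\<in>J. measure \<mu> UNIV * \<bar>\<phi> j - \<phi>' j\<bar>)"
    by (simp add: D_def sum_distrib_left)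
  moreover have "(\<Sum>j\<in>J. w j * \<phi> j) \<le> (\<Sum>j\<in>J. w j * \<phi>' j + \<bar>w j\<bar> * \<bar>\<phi> j - \<phi>' j\<bar>)"
  proof (rule sum_mono)
    fix j
    have "w j * (\<phi> j - \<phi>' j) \<le> \<bar>w j\<bar> * \<bar>\<phi> j - \<phi>' j\<bar>"
      by (metis abs_ge_self abs_mult)
    then show "w j * \<phi> j \<le> w j * \<phi>' j + \<bar>w j\<bar> * \<bar>\<phi> j - \<phi>' j\<bar>"
      by (simp add: right_diff_distrib)
  qed
  ultimately show ?thesis
    by (simp add: kantorovich_functional_def distrib_right sum.distrib)
qed

lemma continuous_on_kantorovich_functional:
  assumes J: "finite J" "J \<noteq> {}"
  shows "continuous_on S (kantorovich_functional \<mu> J w Y)"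
proof -
  let ?K = "kantorovich_functional \<mu> J w Y"
  have "(?K \<longlongrightarrow> ?K \<phi>') (at \<phi>' within S)" for \<phi>'
  proof (rule LIM_zero_cancel, rule Lim_null_comparison)
    let ?D = "\<lambda>\<phi>. \<Sum>j\<in>J. (measure \<mu> UNIV + \<bar>w j\<bar>) * \<bar>\<phi> j - \<phi>' j\<bar>"
    have "norm (?K \<phi> - ?K \<phi>') \<le> ?D \<phi>" for \<phi>
      using kantorovich_functional_lipschitz[OF J, of w Y \<phi> \<phi>']
        kantorovich_functional_lipschitz[OF J, of w Y \<phi>' \<phi>]
      unfolding abs_minus_commute[of "\<phi>' _"] by simp
    then show "\<forall>\<^sub>F \<phi> in at \<phi>' within S. norm (?K \<phi> - ?K \<phi>') \<le> ?D \<phi>"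
      by simp
    have "((\<lambda>\<phi>. \<phi> j) \<longlongrightarrow> \<phi>' j) (at \<phi>' within S)" for j
      using continuous_on_product_coordinates[of j] unfolding continuous_on_def
      by (blast intro: tendsto_within_subset[OF _ subset_UNIV])
    then have "(?D \<longlongrightarrow> (\<Sum>j\<in>J. (measure \<mu> UNIV + \<bar>w j\<bar>) * \<bar>\<phi>' j - \<phi>' j\<bar>)) (at \<phi>' within S)"
      by (intro tendsto_intros)
    then show "(?D \<longlongrightarrow> 0) (at \<phi>' within S)"
      by simp
  qed
  then show ?thesis
    by (simp add: continuous_on_def)
qed

text \<open>The potential gains \<open>c\<close> everywhere and the linear term loses
  \<open>c\<close> times the sum of the \<open>w j\<close>; these cancel because the total masses
  agree.\<close>

lemma kantorovich_functional_shift: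
  assumes J: "finite J" "J \<noteq> {}" and w: "(\<Sum>j\<in>J. w j) = measure \<mu> UNIV"
  shows "kantorovich_functional \<mu> J w Y (\<lambda>j. \<phi> j - c) = kantorovich_functional \<mu> J w Y \<phi>"
proof -
  have "laguerre_potential J (\<lambda>j. \<phi> j - c) Y x = laguerre_potential J \<phi> Y x + c" for x
  proof (rule antisym)
    show "laguerre_potential J (\<lambda>j. \<phi> j - c) Y x \<le> laguerre_potential J \<phi> Y x + c"
      using laguerre_potential_ge[OF J(1), where x=x and Y=Y and \<phi>=\<phi>]
      by (simp add: laguerre_potential_le_iff[OF J] diff_le_eq algebra_simps)
    have "laguerre_potential J \<phi> Y x \<le> laguerre_potential J (\<lambda>j. \<phi> j - c) Y x - c"
      unfolding laguerre_potential_le_iff[OF J]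
    proof
      fix j assume "j \<in> J"
      from laguerre_potential_ge[OF J(1) this, of x Y "\<lambda>j. \<phi> j - c"]
      show "x \<bullet> Y j - \<phi> j \<le> laguerre_potential J (\<lambda>j. \<phi> j - c) Y x - c"
        by simp
    qed
    then show "laguerre_potential J \<phi> Y x + c \<le> laguerre_potential J (\<lambda>j. \<phi> j - c) Y x"
      by simp
  qed
  then show ?thesis
    using integrable_laguerre_potential[OF J] w
    by (simp add: kantorovich_functional_def right_diff_distrib sum_subtractf
        flip: sum_distrib_right)
qed

lemma kantorovich_functional_attains_min:
  assumes J: "finite J" "J \<noteq> {}"
    and w: "\<And>j. j \<in> J \<Longrightarrow> w j > 0" "(\<Sum>j\<in>J. w j) = measure \<mu> UNIV"
  obtains \<phi> where "\<And>\<phi>'. kantorovich_functional \<mu> J w Y \<phi> \<le> kantorovich_functional \<mu> J w Y \<phi>'"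
proof -
  let ?K = "kantorovich_functional \<mu> J w Y"
  define T where "T = \<bar>?K (\<lambda>_. 0)\<bar>"
  define S where "S = (\<Sum>j\<in>J. \<bar>\<integral>x. x \<bullet> Y j \<partial>\<mu>\<bar>)"
  \<comment> \<open>A coordinate above \<open>R\<close> makes the linear term exceed
    \<open>T + S\<close>, while the integral of the potential is at least \<open>- S\<close> thanks
    to an index of weight 0. The functional then exceeds its value at 0. Summing over
    \<open>J\<close> makes one \<open>R\<close> serve all indices.\<close>
  define R where "R = (\<Sum>j\<in>J. (T + S) / w j)"
  \<comment> \<open>Weights are total functions, so for compactness the coordinates outside
    \<open>J\<close> must be confined too; setting them to 0 leaves the functional
    unchanged.\<close>
  define B where "B = PiE UNIV (\<lambda>_::'b. {0..R})"
  have TS: "0 \<le> T + S"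
    by (auto simp: T_def S_def intro!: add_nonneg_nonneg sum_nonneg)
  have "0 \<le> R"
    using TS w by (auto simp: R_def intro!: sum_nonneg divide_nonneg_pos)
  have "compactin (product_topology (\<lambda>_::'b. euclidean) UNIV) B"
    unfolding B_def by (subst compactin_PiE) auto
  then have "compact B"
    by (simp add: euclidean_product_topology compactin_euclidean_iff)
  moreover have B0: "(\<lambda>_. 0) \<in> B"
    using \<open>0 \<le> R\<close> by (simp add: B_def PiE_UNIV_domain)
  ultimately obtain \<phi> where min: "\<And>\<phi>'. \<phi>' \<in> B \<Longrightarrow> ?K \<phi> \<le> ?K \<phi>'"
    using continuous_attains_inf[of B ?K] continuous_on_kantorovich_functional[OF J] by blast
  have "?K \<phi> \<le> ?K \<phi>'" for \<phi>'
  proof -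
    define \<eta> where "\<eta> = (\<lambda>j. \<phi>' j - (MIN j\<in>J. \<phi>' j))"
    have "(MIN j\<in>J. \<phi>' j) \<in> \<phi>' ` J"
      using J by (intro Min_in) auto
    then obtain j0 where j0: "j0 \<in> J" "\<eta> j0 = 0"
      by (auto simp: \<eta>_def)
    have nonneg: "0 \<le> \<eta> j" if "j \<in> J" for j
      using J that by (simp add: \<eta>_def)
    have "?K \<phi> \<le> ?K \<eta>"
    proof (cases "\<forall>j\<in>J. \<eta> j \<le> R")
      case True
      have "?K \<eta> = ?K (\<lambda>j. if j \<in> J then \<eta> j else 0)"
        by (simp add: kantorovich_functional_def laguerre_potential_def cong: sum.cong image_cong)
      also have "\<dots> \<ge> ?K \<phi>"
        using True nonneg \<open>0 \<le> R\<close> by (intro min) (auto simp: B_def)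
      finally show ?thesis .
    next
      case False
      then obtain j where j: "j \<in> J" "R < \<eta> j"
        by auto
      have "(T + S) / w j \<le> R"
        unfolding R_def using J j w TS by (intro member_le_sum) (auto intro: divide_nonneg_pos)
      then have "(T + S) / w j < \<eta> j"
        using j by simp
      then have "T + S < w j * \<eta> j"
        using w(1)[OF j(1)] by (simp add: field_simps)
      also have "w j * \<eta> j \<le> (\<Sum>j\<in>J. w j * \<eta> j)"
      proof (rule member_le_sum)
        show "0 \<le> w k * \<eta> k" if "k \<in> J - {j}" for k
          using nonneg[of k] w(1)[of k] that by simp
      qed (use J j in auto)
      finally have "T + S < (\<Sum>j\<in>J. w j * \<eta> j)" .
      moreover have "- S \<le> (\<integral>x. x \<bullet> Y j0 \<partial>\<mu>)"
      proof -
        have "\<bar>\<integral>x. x \<bullet> Y j0 \<partial>\<mu>\<bar> \<le> S"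
          unfolding S_def using J j0 by (intro member_le_sum) auto
        then show ?thesis by linarith
      qed
      moreover have "(\<integral>x. x \<bullet> Y j0 \<partial>\<mu>) \<le> (\<integral>x. laguerre_potential J \<eta> Y x \<partial>\<mu>)"
        using integrable_laguerre_potential[OF J] integrable_ident
          laguerre_potential_ge[OF J(1) j0(1), of _ Y \<eta>] j0(2)
        by (intro integral_mono) auto
      ultimately have "T < ?K \<eta>"
        by (simp add: kantorovich_functional_def)
      moreover have "?K \<phi> \<le> T"
        using min[OF B0] by (simp add: T_def)
      ultimately show ?thesis
        by simp
    qed
    also have "?K \<eta> = ?K \<phi>'"
      unfolding \<eta>_def by (rule kantorovich_functional_shift[OF J w(2)])
    finally show ?thesis .
  qed
  then show thesis
    using that by blast
qed

end

text \<open>At a minimizer, the one-sided variation that raises a single weight gives volumes at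
  most \<open>w j\<close>. Both families have the same total, so the inequalities are equalities and
  no second variation or differentiability is called for.\<close>

lemma (in hyperplane_null_measure) exists_laguerre_weights:
  assumes J: "finite J" "J \<noteq> {}" and Y: "inj_on Y J"
    and w: "\<And>j. j \<in> J \<Longrightarrow> w j > 0" "(\<Sum>j\<in>J. w j) = measure \<mu> UNIV"
  shows "\<exists>\<phi>. \<forall>j\<in>J. measure \<mu> (laguerre_cell J \<phi> Y j) = w j"
proof -
  let ?K = "kantorovich_functional \<mu> J w Y"
  obtain \<phi> where min: "\<And>\<phi>'. ?K \<phi> \<le> ?K \<phi>'"
    using kantorovich_functional_attains_min[OF J w] by metis
  have le: "measure \<mu> (laguerre_cell J \<phi> Y j) \<le> w j" if j: "j \<in> J" for j
  proof -
    \<comment> \<open>Here piece \<open>j\<close> wins by at least \<open>\<epsilon>\<close>, so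
      raising \<open>\<phi> j\<close> by \<open>\<epsilon>\<close> lowers the maximum by the full
      \<open>\<epsilon>\<close>; elsewhere the maximum does not grow.\<close>
    define A where
      "A \<epsilon> = {x. \<forall>k\<in>J. k \<noteq> j \<longrightarrow> x \<bullet> Y k - \<phi> k + \<epsilon> \<le> x \<bullet> Y j - \<phi> j}" for \<epsilon> :: real
    have A_sets: "A \<epsilon> \<in> sets borel" for \<epsilon>
    proof -
      have "A \<epsilon> = (\<Inter>k\<in>J - {j}. {x. x \<bullet> Y k - \<phi> k + \<epsilon> \<le> x \<bullet> Y j - \<phi> j})"
        by (auto simp: A_def)
      then show ?thesis
        by (auto intro!: borel_closed closed_INT closed_Collect_le continuous_intros)
    qed
    have A_le: "measure \<mu> (A \<epsilon>) \<le> w j" if "\<epsilon> > 0" for \<epsilon>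
    proof -
      let ?\<phi> = "\<phi>(j := \<phi> j + \<epsilon>)"
      have pot: "laguerre_potential J ?\<phi> Y x \<le> laguerre_potential J \<phi> Y x - \<epsilon> * indicator (A \<epsilon>) x" for x
        unfolding laguerre_potential_le_iff[OF J]
      proof
        fix k assume k: "k \<in> J"
        show "x \<bullet> Y k - ?\<phi> k \<le> laguerre_potential J \<phi> Y x - \<epsilon> * indicator (A \<epsilon>) x"
          using \<open>\<epsilon> > 0\<close> k laguerre_potential_ge[OF J(1) k, of x Y \<phi>]
            laguerre_potential_ge[OF J(1) j, of x Y \<phi>]
          by (auto simp: indicator_def A_def)
      qed
      have A_ind: "integrable \<mu> (\<lambda>x. \<epsilon> * indicator (A \<epsilon>) x)"
        using A_sets by (intro integrable_mult_right) (simp add: less_top[symmetric])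
      have "(\<integral>x. laguerre_potential J ?\<phi> Y x \<partial>\<mu>)
          \<le> (\<integral>x. laguerre_potential J \<phi> Y x - \<epsilon> * indicator (A \<epsilon>) x \<partial>\<mu>)"
        using pot integrable_laguerre_potential[OF J] A_ind
        by (intro integral_mono Bochner_Integration.integrable_diff) auto
      also have "\<dots> = (\<integral>x. laguerre_potential J \<phi> Y x \<partial>\<mu>) - \<epsilon> * measure \<mu> (A \<epsilon>)"
        using integrable_laguerre_potential[OF J] A_ind A_sets
        by (subst Bochner_Integration.integral_diff) auto
      finally have "?K ?\<phi> \<le> ?K \<phi> - \<epsilon> * measure \<mu> (A \<epsilon>) + ((\<Sum>k\<in>J. w k * ?\<phi> k) - (\<Sum>k\<in>J. w k * \<phi> k))"
        by (simp add: kantorovich_functional_def)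
      also have "(\<Sum>k\<in>J. w k * ?\<phi> k) - (\<Sum>k\<in>J. w k * \<phi> k) = (\<Sum>k\<in>J. if k = j then w j * \<epsilon> else 0)"
        unfolding sum_subtractf[symmetric] by (intro sum.cong) (auto simp: algebra_simps)
      also have "\<dots> = \<epsilon> * w j"
        using J j by simp
      finally have "\<epsilon> * measure \<mu> (A \<epsilon>) \<le> \<epsilon> * w j"
        using min[of ?\<phi>] by linarith
      then show ?thesis
        using that by simp
    qed
    \<comment> \<open>As the margin shrinks, these sets increase and exhaust the cell except for its
      ties, which are null.\<close>
    have "measure \<mu> (\<Union>n. A (1 / Suc n)) \<le> w j"
    proof (rule LIMSEQ_le_const2)
      show "(\<lambda>n. measure \<mu> (A (1 / Suc n))) \<longlonglongrightarrow> measure \<mu> (\<Union>n. A (1 / Suc n))"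
      proof (rule finite_Lim_measure_incseq)
        show "incseq (\<lambda>n. A (1 / Suc n))"
        proof (rule incseq_SucI, rule subsetI)
          fix n x assume "x \<in> A (1 / Suc n)"
          moreover have "1 / real (Suc (Suc n)) \<le> 1 / real (Suc n)"
            by (intro divide_left_mono) auto
          ultimately show "x \<in> A (1 / Suc (Suc n))"
            unfolding A_def by (force simp del: of_nat_Suc)
        qed
      qed (use A_sets in auto)
    qed (use A_le in auto)
    moreover have "measure \<mu> (laguerre_cell J \<phi> Y j) \<le> measure \<mu> (\<Union>n. A (1 / Suc n))"
    proof (rule finite_measure_mono_AE)
      show "AE x in \<mu>. x \<in> laguerre_cell J \<phi> Y j \<longrightarrow> x \<in> (\<Union>n. A (1 / Suc n))"
        using AE_not_in_two_cells[OF J(1) Y, of \<phi>]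
      proof eventually_elim
        case (elim x)
        show ?case
        proof
          assume x: "x \<in> laguerre_cell J \<phi> Y j"
          have "x \<bullet> Y k - \<phi> k < x \<bullet> Y j - \<phi> j" if "k \<in> J - {j}" for k
            using elim j x that by (intro laguerre_cell_less[where J=J and Y=Y and \<phi>=\<phi>]) auto
          then have "\<forall>k\<in>J - {j}. \<forall>\<^sub>F n in sequentially. 1 / real (Suc n) < (x \<bullet> Y j - \<phi> j) - (x \<bullet> Y k - \<phi> k)"
            using order_tendstoD(2)[OF LIMSEQ_inverse_real_of_nat] by (auto simp: divide_inverse)
          then have "\<forall>\<^sub>F n in sequentially. \<forall>k\<in>J - {j}. 1 / real (Suc n) < (x \<bullet> Y j - \<phi> j) - (x \<bullet> Y k - \<phi> k)"
            using J by (intro eventually_ball_finite) auto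
          then obtain n where "\<forall>k\<in>J - {j}. 1 / real (Suc n) < (x \<bullet> Y j - \<phi> j) - (x \<bullet> Y k - \<phi> k)"
            using eventually_happens'[OF sequentially_bot] by blast
          then have "x \<in> A (1 / Suc n)"
            by (force simp: A_def)
          then show "x \<in> (\<Union>n. A (1 / Suc n))"
            by blast
        qed
      qed
    qed (use A_sets in auto)
    ultimately show ?thesis
      by simp
  qed
  have "measure \<mu> (laguerre_cell J \<phi> Y j) = w j" if "j \<in> J" for j
    by (rule sum_mono_inv[OF _ le that J(1)]) (use sum_measure_cells[OF J Y] w in auto)
  then show ?thesis
    by blast
qed

section \<open>Maximizers of linear forms under domination\<close>

locale laguerre_assignment = hyperplane_null_measure \<mu>
  for \<mu> :: "'a::euclidean_space measure" +
  fixes J :: "'j set" and Y :: "'j \<Rightarrow> 'a" and \<phi> :: "'j \<Rightarrow> real"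
    and I :: "'i set" and v :: "'i \<Rightarrow> real" and \<sigma> :: "'i \<Rightarrow> 'j"
  assumes finite_J: "finite J" and J_nonempty: "J \<noteq> {}" and inj_Y: "inj_on Y J"
    and finite_I: "finite I" and v_nonneg: "i \<in> I \<Longrightarrow> 0 \<le> v i" and \<sigma>_in: "\<sigma> ` I \<subseteq> J"
    and volume: "j \<in> J \<Longrightarrow> measure \<mu> (laguerre_cell J \<phi> Y j) = (\<Sum>i\<in>{i \<in> I. \<sigma> i = j}. v i)"
begin

abbreviation L where "L \<equiv> laguerre_cell J \<phi> Y"
abbreviation u where "u \<equiv> laguerre_potential J \<phi> Y"

text \<open>The value of the linear form when each class of indices has the barycenter of its cell.
  It depends on the cells only and is the upper bound that dominated configurations obey.\<close>

definition max_form :: real where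
  "max_form = (\<Sum>j\<in>J. (LINT x:L j|\<mu>. x) \<bullet> Y j)"

lemma sum_by_class:
  "(\<Sum>j\<in>J. \<Sum>i\<in>{i \<in> I. \<sigma> i = j}. h i) = (\<Sum>i\<in>I. h i)"
  using sum.group[OF finite_I finite_J \<sigma>_in, of h] .

lemma integrable_u: "integrable \<mu> u"
  using finite_J J_nonempty by (rule integrable_laguerre_potential)

lemma integrable_cell:
  fixes f :: "'a \<Rightarrow> 'b::euclidean_space"
  shows "integrable \<mu> f \<Longrightarrow> integrable \<mu> (\<lambda>x. indicator (L j) x *\<^sub>R f x)"
  by (rule integrable_mult_indicator) auto

text \<open>On cell \<open>j\<close> the potential is the single piece
  \<open>x \<bullet> Y j - \<phi> j\<close>; the volume condition turns the mass of the cell into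
  the weights of the indices assigned to it.\<close>

lemma integral_u: "(\<integral>x. u x \<partial>\<mu>) = max_form - (\<Sum>i\<in>I. v i * \<phi> (\<sigma> i))"
proof -
  have "(LINT x:L j|\<mu>. u x) = (LINT x:L j|\<mu>. x) \<bullet> Y j - (\<Sum>i\<in>{i \<in> I. \<sigma> i = j}. v i * \<phi> (\<sigma> i))"
    if j: "j \<in> J" for j
  proof -
    have "(LINT x:L j|\<mu>. u x) = (\<integral>x. (indicator (L j) x *\<^sub>R x) \<bullet> Y j - \<phi> j * indicator (L j) x \<partial>\<mu>)"
      unfolding set_lebesgue_integral_def
    proof (rule Bochner_Integration.integral_cong[OF refl])
      show "indicator (L j) x *\<^sub>R u x = (indicator (L j) x *\<^sub>R x) \<bullet> Y j - \<phi> j * indicator (L j) x" for x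
        using laguerre_potential_on_cell[OF finite_J j] by (auto simp: indicator_def)
    qed
    also have "\<dots> = (\<integral>x. (indicator (L j) x *\<^sub>R x) \<bullet> Y j \<partial>\<mu>) - (\<integral>x. \<phi> j * indicator (L j) x \<partial>\<mu>)"
      by (intro Bochner_Integration.integral_diff integrable_inner_left integrable_mult_right
          integrable_cell integrable_ident) (simp add: less_top[symmetric])
    also have "\<dots> = (LINT x:L j|\<mu>. x) \<bullet> Y j - \<phi> j * measure \<mu> (L j)"
      by (subst integral_inner_left) (simp_all add: integrable_cell integrable_ident set_lebesgue_integral_def)
    also have "\<phi> j * measure \<mu> (L j) = (\<Sum>i\<in>{i \<in> I. \<sigma> i = j}. v i * \<phi> (\<sigma> i))"
      using volume[OF j] by (simp add: sum_distrib_left mult.commute)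
    finally show ?thesis .
  qed
  then have "(\<Sum>j\<in>J. LINT x:L j|\<mu>. u x) = max_form - (\<Sum>i\<in>I. v i * \<phi> (\<sigma> i))"
    using sum_by_class[of "\<lambda>i. v i * \<phi> (\<sigma> i)"] by (simp add: max_form_def sum_subtractf)
  then show ?thesis
    using integral_split_cells[OF finite_J J_nonempty inj_Y integrable_u] by simp
qed

lemma linear_form_le:
  assumes "dominated_by I v b \<mu>"
  shows "(\<Sum>i\<in>I. v i * (b i \<bullet> Y (\<sigma> i))) \<le> max_form"
proof -
  have "(\<Sum>i\<in>I. v i * (b i \<bullet> Y (\<sigma> i) - \<phi> (\<sigma> i))) \<le> (\<Sum>i\<in>I. v i * u (b i))"
    using v_nonneg \<sigma>_in finite_J
    by (intro sum_mono mult_left_mono laguerre_potential_ge) auto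
  also have "\<dots> \<le> (\<integral>x. u x \<partial>\<mu>)"
    using assms lin_growth_convex_laguerre_potential[OF finite_J J_nonempty]
    by (rule dominated_byD)
  finally show ?thesis
    by (simp add: integral_u right_diff_distrib sum_subtractf)
qed

text \<open>Equality in the linear form is tested against the perturbed potential in which only the
  affine piece of index \<open>j\<close> is replaced by itself plus \<open>\<epsilon> \<psi>\<close>. As \<open>\<epsilon> \<rightarrow> 0\<close> the difference
  quotient converges almost everywhere to \<open>\<psi>\<close> on the cell of index \<open>j\<close> and to 0 elsewhere.\<close>

lemma restricted_domination_if_maximizer:
  assumes dom: "dominated_by I v b \<mu>"
    and eq: "(\<Sum>i\<in>I. v i * (b i \<bullet> Y (\<sigma> i))) = max_form" and j: "j \<in> J"
  shows "dominated_by {i \<in> I. \<sigma> i = j} v b (measure_restr \<mu> (L j))"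
  unfolding dominated_by_def
proof (intro allI impI)
  fix \<psi> :: "'a \<Rightarrow> real" assume \<psi>: "lin_growth_convex \<psi>"
  define l where "l k x = x \<bullet> Y k - \<phi> k" for k x
  define f where "f \<epsilon> k x = l k x + (if k = j then \<epsilon> * \<psi> x else 0)" for \<epsilon> :: real and k x
  define g where "g \<epsilon> x = (MAX k\<in>J. f \<epsilon> k x)" for \<epsilon> x
  have g_ge: "f \<epsilon> k x \<le> g \<epsilon> x" if "k \<in> J" for \<epsilon> k x
    unfolding g_def using finite_J that by simp
  have g_le: "g \<epsilon> x \<le> c" if "\<And>k. k \<in> J \<Longrightarrow> f \<epsilon> k x \<le> c" for \<epsilon> x c
    unfolding g_def using finite_J J_nonempty that by simp
  have u_ge: "l k x \<le> u x" if "k \<in> J" for k x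
    unfolding l_def using finite_J that by (rule laguerre_potential_ge)
  have u_le: "u x \<le> c" if "\<And>k. k \<in> J \<Longrightarrow> l k x \<le> c" for x c
    using that by (simp add: laguerre_potential_le_iff[OF finite_J J_nonempty] l_def)
  have g_conv: "lin_growth_convex (g \<epsilon>)" if "\<epsilon> > 0" for \<epsilon>
    unfolding g_def
  proof (rule lin_growth_convex_Max[OF finite_J J_nonempty])
    have "lin_growth_convex (l k)" for k
      unfolding l_def using lin_growth_convex_affine[of "Y k" "- \<phi> k"] by simp
    then show "lin_growth_convex (f \<epsilon> k)" for k
      unfolding f_def using \<psi> that lin_growth_convex_cmul[OF \<psi>, of \<epsilon>]
      by (cases "k = j") (auto intro: lin_growth_convex_add)
  qed
  have step: "(\<Sum>i\<in>{i \<in> I. \<sigma> i = j}. v i * \<psi> (b i)) \<le> (\<integral>x. (g \<epsilon> x - u x) / \<epsilon> \<partial>\<mu>)"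
    if \<epsilon>: "\<epsilon> > 0" for \<epsilon>
  proof -
    have "(\<Sum>i\<in>I. v i * f \<epsilon> (\<sigma> i) (b i)) \<le> (\<Sum>i\<in>I. v i * g \<epsilon> (b i))"
      using v_nonneg \<sigma>_in by (intro sum_mono mult_left_mono g_ge) auto
    also have "\<dots> \<le> (\<integral>x. g \<epsilon> x \<partial>\<mu>)"
      using dom g_conv[OF \<epsilon>] by (rule dominated_byD)
    finally have "(\<Sum>i\<in>I. v i * f \<epsilon> (\<sigma> i) (b i)) \<le> (\<integral>x. g \<epsilon> x \<partial>\<mu>)" .
    moreover have "(\<Sum>i\<in>I. v i * f \<epsilon> (\<sigma> i) (b i))
        = (\<Sum>i\<in>I. v i * l (\<sigma> i) (b i)) + \<epsilon> * (\<Sum>i\<in>I. if \<sigma> i = j then v i * \<psi> (b i) else 0)"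
      unfolding f_def sum_distrib_left sum.distrib[symmetric]
      by (intro sum.cong) (auto simp: algebra_simps)
    \<comment> \<open>Maximality enters here: the zeroth-order terms on both sides are equal, so
      only the terms proportional to \<open>\<epsilon>\<close> are left to compare.\<close>
    moreover have "(\<Sum>i\<in>I. v i * l (\<sigma> i) (b i)) = (\<integral>x. u x \<partial>\<mu>)"
      unfolding integral_u l_def eq[symmetric] by (simp add: right_diff_distrib sum_subtractf)
    moreover have "(\<Sum>i\<in>I. if \<sigma> i = j then v i * \<psi> (b i) else 0) = (\<Sum>i\<in>{i \<in> I. \<sigma> i = j}. v i * \<psi> (b i))"
      using finite_I by (simp add: sum.inter_filter)
    ultimately have "\<epsilon> * (\<Sum>i\<in>{i \<in> I. \<sigma> i = j}. v i * \<psi> (b i)) \<le> (\<integral>x. g \<epsilon> x - u x \<partial>\<mu>)"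
      using integrable_u integrable_lin_growth_convex[OF g_conv[OF \<epsilon>]] by simp
    then show ?thesis
      using \<epsilon> by (simp add: field_simps)
  qed
  define r where "r n = 1 / real (Suc n)" for n
  have r: "r n > 0" for n
    by (simp add: r_def)
  have r_lim: "(\<lambda>n. c + r n * d) \<longlonglongrightarrow> c" for c d
    using tendsto_add[OF tendsto_const[of c] tendsto_mult[OF LIMSEQ_inverse_real_of_nat tendsto_const[of d]]]
    by (simp add: r_def divide_inverse)
  \<comment> \<open>A perturbation of one piece moves the maximum by no more than itself. This
    supplies the integrable majorant \<open>\<bar>\<psi>\<bar>\<close> for dominated
    convergence.\<close>
  have bound: "\<bar>(g \<epsilon> x - u x) / \<epsilon>\<bar> \<le> \<bar>\<psi> x\<bar>" if \<epsilon>: "\<epsilon> > 0" for \<epsilon> x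
  proof -
    have abs: "\<bar>\<epsilon> * \<psi> x\<bar> = \<epsilon> * \<bar>\<psi> x\<bar>"
      using \<epsilon> by (simp add: abs_mult)
    have nonneg: "0 \<le> \<epsilon> * \<bar>\<psi> x\<bar>"
      using \<epsilon> by simp
    have "f \<epsilon> k x \<le> u x + \<epsilon> * \<bar>\<psi> x\<bar>" if "k \<in> J" for k
      using u_ge[OF that, of x] abs nonneg unfolding f_def by (cases "k = j") auto
    then have "g \<epsilon> x \<le> u x + \<epsilon> * \<bar>\<psi> x\<bar>"
      by (rule g_le)
    moreover have "l k x \<le> g \<epsilon> x + \<epsilon> * \<bar>\<psi> x\<bar>" if "k \<in> J" for k
      using g_ge[OF that, of \<epsilon> x] abs nonneg unfolding f_def by (cases "k = j") auto
    then have "u x \<le> g \<epsilon> x + \<epsilon> * \<bar>\<psi> x\<bar>"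
      by (rule u_le)
    ultimately show ?thesis
      using \<epsilon> by (simp add: abs_le_iff field_simps)
  qed
  have AE_lim: "AE x in \<mu>. (\<lambda>n. (g (r n) x - u x) / r n) \<longlonglongrightarrow> indicator (L j) x *\<^sub>R \<psi> x"
    using AE_not_in_two_cells[OF finite_J inj_Y, of \<phi>]
  proof eventually_elim
    case (elim x)
    obtain m where m: "m \<in> J" "x \<in> L m"
      using laguerre_cells_cover[OF finite_J J_nonempty] by blast
    \<comment> \<open>Off the ties the winning piece is strictly ahead. At such a fixed point the
      winner is unchanged for large \<open>n\<close>, so the quotient is eventually equal to its
      limit.\<close>
    have less: "l k x < l m x" if "k \<in> J - {m}" for k
      unfolding l_def using elim m that by (intro laguerre_cell_less[where J=J]) auto
    have u: "u x = l m x"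
      using laguerre_potential_on_cell[OF finite_J m] by (simp add: l_def)
    have "\<forall>\<^sub>F n in sequentially. (g (r n) x - u x) / r n = indicator (L j) x *\<^sub>R \<psi> x"
    proof (cases "m = j")
      case True
      have "\<forall>k\<in>J - {j}. \<forall>\<^sub>F n in sequentially. l k x < l j x + r n * \<psi> x"
        using less True order_tendstoD(1)[OF r_lim] by blast
      then have "\<forall>\<^sub>F n in sequentially. \<forall>k\<in>J - {j}. l k x < l j x + r n * \<psi> x"
        using finite_J by (intro eventually_ball_finite) auto
      then show ?thesis
      proof eventually_elim
        case (elim n)
        have "g (r n) x = l j x + r n * \<psi> x"
        proof (rule antisym)
          show "g (r n) x \<le> l j x + r n * \<psi> x"
            using elim by (intro g_le) (auto simp: f_def intro: less_imp_le)
          show "l j x + r n * \<psi> x \<le> g (r n) x"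
            using g_ge[OF j, of "r n" x] by (simp add: f_def)
        qed
        then show ?case
          using u m True r[of n] by simp
      qed
    next
      case False
      then have "\<forall>\<^sub>F n in sequentially. l j x + r n * \<psi> x < l m x"
        using less j order_tendstoD(2)[OF r_lim] by blast
      then show ?thesis
      proof eventually_elim
        case (elim n)
        have "g (r n) x = l m x"
        proof (rule antisym)
          show "g (r n) x \<le> l m x"
            using elim u_ge[where x=x, unfolded u] by (intro g_le) (auto simp: f_def)
          show "l m x \<le> g (r n) x"
            using g_ge[OF m(1), of "r n" x] False by (simp add: f_def)
        qed
        moreover have "x \<notin> L j"
          using \<open>\<forall>j\<in>J. \<forall>k\<in>J. j \<noteq> k \<longrightarrow> \<not> (x \<in> L j \<and> x \<in> L k)\<close> m j False by blast
        ultimately show ?case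
          using u by simp
      qed
    qed
    then show ?case
      by (rule tendsto_eventually)
  qed
  have "(\<lambda>n. \<integral>x. (g (r n) x - u x) / r n \<partial>\<mu>) \<longlonglongrightarrow> (\<integral>x. indicator (L j) x *\<^sub>R \<psi> x \<partial>\<mu>)"
  proof (rule integral_dominated_convergence[where w="\<lambda>x. \<bar>\<psi> x\<bar>"])
    show "(\<lambda>x. indicator (L j) x *\<^sub>R \<psi> x) \<in> borel_measurable \<mu>"
      using lin_growth_convex_measurable[OF \<psi>] by simp
    show "(\<lambda>x. (g (r n) x - u x) / r n) \<in> borel_measurable \<mu>" for n
      using lin_growth_convex_measurable[OF g_conv[OF r]] integrable_u by auto
    show "integrable \<mu> (\<lambda>x. \<bar>\<psi> x\<bar>)"
      using integrable_lin_growth_convex[OF \<psi>] by simp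
    show "AE x in \<mu>. norm ((g (r n) x - u x) / r n) \<le> \<bar>\<psi> x\<bar>" for n
      using bound[OF r] by simp
  qed (rule AE_lim)
  then have "(\<Sum>i\<in>{i \<in> I. \<sigma> i = j}. v i * \<psi> (b i)) \<le> (\<integral>x. indicator (L j) x *\<^sub>R \<psi> x \<partial>\<mu>)"
    by (rule LIMSEQ_le_const) (use step r in blast)
  then show "(\<Sum>i\<in>{i \<in> I. \<sigma> i = j}. v i * \<psi> (b i)) \<le> (\<integral>x. \<psi> x \<partial>measure_restr \<mu> (L j))"
    using lin_growth_convex_measurable[OF \<psi>]
    by (simp add: integral_measure_restr set_lebesgue_integral_def)
qed

text \<open>Domination adds up over the cells, and domination on one cell fixes the barycenter of
  its class, hence the contribution of that class to the form.\<close>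

lemma maximizer_if_restricted_domination:
  assumes dom: "\<And>j. j \<in> J \<Longrightarrow> dominated_by {i \<in> I. \<sigma> i = j} v b (measure_restr \<mu> (L j))"
  shows "dominated_by I v b \<mu>" "(\<Sum>i\<in>I. v i * (b i \<bullet> Y (\<sigma> i))) = max_form"
proof -
  show "dominated_by I v b \<mu>"
    unfolding dominated_by_def
  proof (intro allI impI)
    fix \<psi> :: "'a \<Rightarrow> real" assume \<psi>: "lin_growth_convex \<psi>"
    have "(\<Sum>j\<in>J. \<Sum>i\<in>{i \<in> I. \<sigma> i = j}. v i * \<psi> (b i)) \<le> (\<Sum>j\<in>J. LINT x:L j|\<mu>. \<psi> x)"
      using dominated_byD[OF dom \<psi>] lin_growth_convex_measurable[OF \<psi>]
      by (intro sum_mono) (simp add: integral_measure_restr)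
    then show "(\<Sum>i\<in>I. v i * \<psi> (b i)) \<le> (\<integral>x. \<psi> x \<partial>\<mu>)"
      using integral_split_cells[OF finite_J J_nonempty inj_Y integrable_lin_growth_convex[OF \<psi>]]
      by (simp add: sum_by_class)
  qed
  have "(\<Sum>i\<in>{i \<in> I. \<sigma> i = j}. v i * (b i \<bullet> Y (\<sigma> i))) = (LINT x:L j|\<mu>. x) \<bullet> Y j" if j: "j \<in> J" for j
  proof -
    interpret R: first_moment_measure "measure_restr \<mu> (L j)"
      by (rule first_moment_measure_restr) simp
    have "(\<Sum>i\<in>{i \<in> I. \<sigma> i = j}. v i * (b i \<bullet> Y (\<sigma> i))) = (\<Sum>i\<in>{i \<in> I. \<sigma> i = j}. v i *\<^sub>R b i) \<bullet> Y j"
      unfolding inner_sum_left by (intro sum.cong) auto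
    then show ?thesis
      using R.dominated_by_barycenter[OF dom[OF j]] integral_measure_restr[of "L j" "\<lambda>x. x"] by simp
  qed
  then show "(\<Sum>i\<in>I. v i * (b i \<bullet> Y (\<sigma> i))) = max_form"
    unfolding max_form_def by (subst sum_by_class[symmetric]) simp
qed

theorem maximizer_iff_restricted_domination:
  "dominated_by I v b \<mu> \<and> (\<Sum>i\<in>I. v i * (b i \<bullet> Y (\<sigma> i))) = max_form \<longleftrightarrow>
    (\<forall>j\<in>J. dominated_by {i \<in> I. \<sigma> i = j} v b (measure_restr \<mu> (L j)))"
  using restricted_domination_if_maximizer maximizer_if_restricted_domination by blast

end

section \<open>Configurations near the barycenter\<close>

text \<open>Jensen's inequality: integrate the tangent of \<open>\<psi>\<close> at \<open>c\<close>,
  whose linear part has integral zero.\<close>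

lemma (in first_moment_measure) dominated_by_if_barycenter:
  assumes mass: "(\<Sum>i\<in>I. v i) = measure \<mu> UNIV" and c: "measure \<mu> UNIV *\<^sub>R c = (\<integral>x. x \<partial>\<mu>)"
    and b: "\<And>i. i \<in> I \<Longrightarrow> b i = c"
  shows "dominated_by I v b \<mu>"
  unfolding dominated_by_def
proof (intro allI impI)
  fix \<psi> :: "'a \<Rightarrow> real" assume \<psi>: "lin_growth_convex \<psi>"
  then obtain p where p: "\<And>x. \<psi> c + (x - c) \<bullet> p \<le> \<psi> x"
    using lin_growth_convex_subgradient by blast
  have int: "integrable \<mu> (\<lambda>x. (x - c) \<bullet> p)"
    using integrable_ident by simp
  have "(\<Sum>i\<in>I. v i * \<psi> (b i)) = measure \<mu> UNIV * \<psi> c"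
    using b mass by (simp flip: sum_distrib_right)
  also have "\<dots> = (\<integral>x. \<psi> c + (x - c) \<bullet> p \<partial>\<mu>)"
    using int integrable_ident by (simp add: inner_diff_left flip: c)
  also have "\<dots> \<le> (\<integral>x. \<psi> x \<partial>\<mu>)"
    using p int integrable_lin_growth_convex[OF \<psi>] by (intro integral_mono) auto
  finally show "(\<Sum>i\<in>I. v i * \<psi> (b i)) \<le> (\<integral>x. \<psi> x \<partial>\<mu>)" .
qed

context hyperplane_null_measure
begin

text \<open>The integral is continuous and positively homogeneous in \<open>p\<close>, and positive
  for \<open>p \<noteq> 0\<close> because no hyperplane through \<open>c\<close> carries the
  measure. Its minimum over the unit sphere serves as \<open>\<delta>\<close>.\<close>

lemma integral_positive_part_lower_bound:
  assumes mass: "measure \<mu> UNIV > 0" and c: "measure \<mu> UNIV *\<^sub>R c = (\<integral>x. x \<partial>\<mu>)"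
  obtains \<delta> where "\<delta> > 0" "\<And>p. \<delta> * norm p \<le> (\<integral>x. max 0 ((x - c) \<bullet> p) \<partial>\<mu>)"
proof -
  define g where "g p = (\<integral>x. max 0 ((x - c) \<bullet> p) \<partial>\<mu>)" for p
  have int: "integrable \<mu> (\<lambda>x. (x - c) \<bullet> p)" for p
    using integrable_ident by simp
  have int_max: "integrable \<mu> (\<lambda>x. max 0 ((x - c) \<bullet> p))" for p
    using int by simp
  have int_norm: "integrable \<mu> (\<lambda>x. norm (x - c))"
    using integrable_ident by simp
  have g_pos: "g p > 0" if "p \<noteq> 0" for p
  proof (rule ccontr)
    assume "\<not> g p > 0"
    moreover have "g p \<ge> 0"
      unfolding g_def by (intro Bochner_Integration.integral_nonneg) simp
    ultimately have "g p = 0"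
      by simp
    moreover have "(\<integral>x. (x - c) \<bullet> p \<partial>\<mu>) = 0"
      using integrable_ident by (simp add: inner_diff_left flip: c)
    \<comment> \<open>Since \<open>c\<close> is the barycenter, the positive and negative parts have
      equal integrals; if one vanishes, so does the integral of the absolute value.\<close>
    moreover have "(\<integral>x. \<bar>(x - c) \<bullet> p\<bar> \<partial>\<mu>) = (\<integral>x. 2 * max 0 ((x - c) \<bullet> p) - (x - c) \<bullet> p \<partial>\<mu>)"
      by (intro Bochner_Integration.integral_cong) auto
    ultimately have "(\<integral>x. \<bar>(x - c) \<bullet> p\<bar> \<partial>\<mu>) = 0"
      using int int_max unfolding g_def by simp
    then have "AE x in \<mu>. \<bar>(x - c) \<bullet> p\<bar> = 0"
      using int by (subst (asm) integral_nonneg_eq_0_iff_AE) auto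
    moreover have "AE x in \<mu>. x \<notin> {x. x \<bullet> p = c \<bullet> p}"
      using that by (intro AE_not_in hyperplane_null)
    ultimately have "AE x in \<mu>. False"
      by eventually_elim (simp add: inner_diff_left)
    then have "emeasure \<mu> UNIV = 0"
      using AE_iff_measurable[of UNIV \<mu> "\<lambda>_. False"] by simp
    then show False
      using mass by (simp add: measure_def)
  qed
  have g_diff: "g p - g q \<le> (\<integral>x. norm (x - c) \<partial>\<mu>) * norm (p - q)" for p q
  proof -
    have "max 0 ((x - c) \<bullet> p) - max 0 ((x - c) \<bullet> q) \<le> norm (x - c) * norm (p - q)" for x
    proof -
      have "(x - c) \<bullet> p - (x - c) \<bullet> q \<le> norm (x - c) * norm (p - q)"
        using norm_cauchy_schwarz[of "x - c" "p - q"] by (simp add: inner_diff_right)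
      moreover have "0 \<le> norm (x - c) * norm (p - q)"
        by simp
      ultimately show ?thesis
        by linarith
    qed
    then have "(\<integral>x. max 0 ((x - c) \<bullet> p) - max 0 ((x - c) \<bullet> q) \<partial>\<mu>) \<le> (\<integral>x. norm (x - c) * norm (p - q) \<partial>\<mu>)"
      using int_max int_norm by (intro integral_mono) auto
    then show ?thesis
      using int_max int_norm by (simp add: g_def)
  qed
  have "continuous_on (sphere 0 1) g"
  proof (rule lipschitz_on_continuous_on, rule lipschitz_onI)
    show "dist (g p) (g q) \<le> (\<integral>x. norm (x - c) \<partial>\<mu>) * dist p q" for p q
      using g_diff[of p q] g_diff[of q p] by (simp add: dist_norm norm_minus_commute[of q] abs_le_iff)
  qed (auto intro!: Bochner_Integration.integral_nonneg)
  moreover obtain e :: 'a where "norm e = 1"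
    using vector_choose_size zero_le_one by blast
  then have "sphere 0 1 \<noteq> ({} :: 'a set)"
    by auto
  ultimately obtain e where e: "norm e = 1" "\<And>p. norm p = 1 \<Longrightarrow> g e \<le> g p"
    using continuous_attains_inf[of "sphere 0 1" g] by auto
  have "g e * norm p \<le> g p" for p
  proof (cases "p = 0")
    case False
    have "g p = (\<integral>x. norm p * max 0 ((x - c) \<bullet> sgn p) \<partial>\<mu>)"
      unfolding g_def
    proof (intro Bochner_Integration.integral_cong refl)
      fix x
      have "(x - c) \<bullet> p = norm p * ((x - c) \<bullet> sgn p)"
        using False by (simp add: sgn_div_norm)
      then show "max 0 ((x - c) \<bullet> p) = norm p * max 0 ((x - c) \<bullet> sgn p)"
        by (simp add: max_mult_distrib_left)
    qed
    also have "\<dots> = norm p * g (sgn p)"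
      by (simp add: g_def)
    finally show ?thesis
      using e(2)[of "sgn p"] False by (simp add: norm_sgn mult.commute mult_left_mono)
  qed (simp add: g_def)
  moreover have "g e > 0"
    using e(1) by (intro g_pos) auto
  ultimately show thesis
    using that unfolding g_def by blast
qed

text \<open>A convex function that is nonnegative and vanishes at \<open>c\<close> can be large at a
  nearby point only if its slope there is large, and then its integral is large too. The radius
  depends on the measure alone, uniformly in the test function and the weights.\<close>

lemma dominated_by_near_barycenter:
  assumes mass: "measure \<mu> UNIV > 0" and c: "measure \<mu> UNIV *\<^sub>R c = (\<integral>x. x \<partial>\<mu>)"
  obtains \<epsilon> where "\<epsilon> > 0"
    "\<And>(I :: 'i set) v b. (\<And>i. i \<in> I \<Longrightarrow> 0 \<le> v i) \<Longrightarrow> (\<Sum>i\<in>I. v i) = measure \<mu> UNIV \<Longrightarrow>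
      (\<Sum>i\<in>I. v i *\<^sub>R b i) = (\<integral>x. x \<partial>\<mu>) \<Longrightarrow> (\<And>i. i \<in> I \<Longrightarrow> norm (b i - c) \<le> \<epsilon>) \<Longrightarrow>
      dominated_by I v b \<mu>"
proof -
  let ?m = "measure \<mu> UNIV"
  obtain \<delta> where \<delta>: "\<delta> > 0" "\<And>p. \<delta> * norm p \<le> (\<integral>x. max 0 ((x - c) \<bullet> p) \<partial>\<mu>)"
    using integral_positive_part_lower_bound[OF mass c] by metis
  \<comment> \<open>Moving the base point from \<open>b i\<close> to \<open>c\<close> costs
    \<open>\<epsilon> * norm q\<close> twice: once in bounding \<open>\<theta> (b i)\<close> and
    once, with factor \<open>?m\<close>, in the integral. The 2 makes the remaining half of
    \<open>\<delta>\<close> pay for the first.\<close>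
  define \<epsilon> where "\<epsilon> = \<delta> / (2 * ?m)"
  have \<epsilon>: "\<epsilon> > 0" "\<delta> - ?m * \<epsilon> = ?m * \<epsilon>"
    using \<delta>(1) mass by (auto simp: \<epsilon>_def field_simps)
  have "dominated_by I v b \<mu>"
    if v: "\<And>i. i \<in> I \<Longrightarrow> 0 \<le> v i" and v_mass: "(\<Sum>i\<in>I. v i) = ?m"
      and bary: "(\<Sum>i\<in>I. v i *\<^sub>R b i) = (\<integral>x. x \<partial>\<mu>)"
      and b: "\<And>i. i \<in> I \<Longrightarrow> norm (b i - c) \<le> \<epsilon>" for I :: "'i set" and v b
    unfolding dominated_by_def
  proof (intro allI impI)
    fix \<psi> :: "'a \<Rightarrow> real" assume \<psi>: "lin_growth_convex \<psi>"
    then obtain p where p: "\<And>x. \<psi> c + (x - c) \<bullet> p \<le> \<psi> x"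
      using lin_growth_convex_subgradient by blast
    \<comment> \<open>Subtracting the tangent at \<open>c\<close> is harmless: mass and barycenter
      agree, so the affine part contributes equally to both sides of the claim.\<close>
    define \<theta> where "\<theta> x = \<psi> x + (x \<bullet> (- p) + (c \<bullet> p - \<psi> c))" for x
    have \<theta>: "lin_growth_convex \<theta>"
      unfolding \<theta>_def using \<psi> lin_growth_convex_affine by (rule lin_growth_convex_add)
    have \<theta>_nonneg: "0 \<le> \<theta> x" for x
      using p[of x] by (simp add: \<theta>_def inner_diff_left)
    have \<theta>_c: "\<theta> c = 0"
      by (simp add: \<theta>_def)
    have "?m * \<theta> (b i) \<le> (\<integral>x. \<theta> x \<partial>\<mu>)" if i: "i \<in> I" for i
    proof -
      obtain q where q: "\<And>x. \<theta> (b i) + (x - b i) \<bullet> q \<le> \<theta> x"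
        using \<theta> lin_growth_convex_subgradient by blast
      have "(b i - c) \<bullet> q \<le> norm (b i - c) * norm q"
        by (rule norm_cauchy_schwarz)
      also have "\<dots> \<le> \<epsilon> * norm q"
        using b[OF i] by (intro mult_right_mono) auto
      finally have bq: "(b i - c) \<bullet> q \<le> \<epsilon> * norm q" .
      have "0 \<le> \<epsilon> * norm q"
        using \<epsilon>(1) by simp
      \<comment> \<open>The tangent of \<open>\<theta>\<close> at \<open>b i\<close>, re-centred at
        \<open>c\<close>, combined with \<open>\<theta> \<ge> 0\<close>.\<close>
      have le: "max 0 ((x - c) \<bullet> q) - \<epsilon> * norm q \<le> \<theta> x" for x
        using q[of x] bq \<theta>_nonneg[of x] \<theta>_nonneg[of "b i"] \<open>0 \<le> \<epsilon> * norm q\<close>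
        by (auto simp: inner_diff_left max_def)
      have "\<theta> (b i) \<le> \<epsilon> * norm q"
        using q[of c] bq \<theta>_c by (simp add: inner_diff_left)
      then have "?m * \<theta> (b i) \<le> ?m * (\<epsilon> * norm q)"
        using mass by simp
      also have "\<dots> = \<delta> * norm q - ?m * (\<epsilon> * norm q)"
        using \<epsilon>(2) by (simp flip: mult.assoc left_diff_distrib)
      also have "\<dots> \<le> (\<integral>x. max 0 ((x - c) \<bullet> q) \<partial>\<mu>) - ?m * (\<epsilon> * norm q)"
        using \<delta>(2) by simp
      also have "\<dots> = (\<integral>x. max 0 ((x - c) \<bullet> q) - \<epsilon> * norm q \<partial>\<mu>)"
        using integrable_ident by simp
      also have "\<dots> \<le> (\<integral>x. \<theta> x \<partial>\<mu>)"
        using le integrable_ident integrable_lin_growth_convex[OF \<theta>] by (intro integral_mono) auto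
      finally show ?thesis .
    qed
    then have "v i * \<theta> (b i) \<le> v i * ((\<integral>x. \<theta> x \<partial>\<mu>) / ?m)" if "i \<in> I" for i
      using that v mass by (intro mult_left_mono) (auto simp: field_simps)
    then have "(\<Sum>i\<in>I. v i * \<theta> (b i)) \<le> (\<Sum>i\<in>I. v i * ((\<integral>x. \<theta> x \<partial>\<mu>) / ?m))"
      by (rule sum_mono)
    also have "\<dots> = (\<integral>x. \<theta> x \<partial>\<mu>)"
      unfolding sum_distrib_right[symmetric] v_mass using mass by simp
    finally have "(\<Sum>i\<in>I. v i * \<theta> (b i)) \<le> (\<integral>x. \<theta> x \<partial>\<mu>)" .
    moreover have "(\<Sum>i\<in>I. v i * \<theta> (b i))
        = (\<Sum>i\<in>I. v i * \<psi> (b i)) + ((\<Sum>i\<in>I. v i *\<^sub>R b i) \<bullet> (- p) + ?m * (c \<bullet> p - \<psi> c))"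
      unfolding \<theta>_def inner_sum_left v_mass[symmetric] sum_distrib_right sum.distrib[symmetric]
      by (intro sum.cong) (auto simp: algebra_simps)
    moreover have "(\<integral>x. \<theta> x \<partial>\<mu>) = (\<integral>x. \<psi> x \<partial>\<mu>) + ((\<integral>x. x \<partial>\<mu>) \<bullet> (- p) + ?m * (c \<bullet> p - \<psi> c))"
      unfolding \<theta>_def using integrable_ident integrable_lin_growth_convex[OF \<psi>] by simp
    ultimately show "(\<Sum>i\<in>I. v i * \<psi> (b i)) \<le> (\<integral>x. \<psi> x \<partial>\<mu>)"
      using bary by simp
  qed
  with \<epsilon>(1) show thesis
    using that by blast
qed

end

section \<open>The set of dominated configurations and its exposed faces\<close>

text \<open>The constraints say that \<open>B\<close> is orthogonal to the vectors
  \<open>g (j, e)\<close>, which are pairwise orthogonal and, by surjectivity of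
  \<open>\<sigma>\<close>, nonzero. So they cut the dimension by exactly \<open>card J\<close> times
  \<open>CARD('d)\<close>.\<close>

lemma dim_weighted_class_sums_zero:
  fixes v :: "real ^ 'n" and \<sigma> :: "'n \<Rightarrow> 'j"
  assumes v: "\<And>i. v $ i > 0" and \<sigma>: "range \<sigma> = J"
  shows "dim {B :: (real ^ 'd) ^ 'n. \<forall>j\<in>J. (\<Sum>i\<in>\<sigma> -` {j}. v $ i *\<^sub>R B $ i) = 0}
    = CARD('d) * (CARD('n) - card J)"
proof -
  define g :: "'j \<times> (real ^ 'd) \<Rightarrow> (real ^ 'd) ^ 'n" where
    "g = (\<lambda>(j, e). \<chi> i. if \<sigma> i = j then v $ i *\<^sub>R e else 0)"
  define V where "V = g ` (J \<times> Basis)"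
  have inner_g: "g (j, e) \<bullet> B = e \<bullet> (\<Sum>i\<in>\<sigma> -` {j}. v $ i *\<^sub>R B $ i)" for j e B
  proof -
    have "g (j, e) \<bullet> B = (\<Sum>i\<in>UNIV. if \<sigma> i = j then v $ i * (e \<bullet> B $ i) else 0)"
      unfolding inner_vec_def[of "g (j, e)" B] by (intro sum.cong) (auto simp: g_def)
    also have "\<dots> = (\<Sum>i\<in>\<sigma> -` {j}. v $ i * (e \<bullet> B $ i))"
      by (subst sum.inter_filter[symmetric]) (auto simp: vimage_def)
    finally show ?thesis
      by (simp add: inner_sum_right)
  qed
  have orth: "g (j, e) \<bullet> g (k, d) = 0" if "(j, e) \<noteq> (k, d)" "e \<in> Basis" "d \<in> Basis" for j k e d
  proof (cases "j = k")
    case True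
    then have "e \<bullet> d = 0"
      using that inner_not_same_Basis by blast
    then show ?thesis
      unfolding inner_g inner_sum_right by (intro sum.neutral) (auto simp: g_def)
  next
    case False
    then have "(\<Sum>i\<in>\<sigma> -` {j}. v $ i *\<^sub>R g (k, d) $ i) = 0"
      by (intro sum.neutral) (auto simp: g_def)
    then show ?thesis
      by (simp add: inner_g)
  qed
  have nz: "g (j, e) \<noteq> 0" if j: "j \<in> J" and e: "e \<in> Basis" for j e
  proof -
    obtain i where "\<sigma> i = j"
      using \<sigma> j by blast
    then have "g (j, e) $ i = v $ i *\<^sub>R e"
      by (simp add: g_def)
    then show ?thesis
      using v[of i] nonzero_Basis[OF e] by auto
  qed
  have "inj_on g (J \<times> Basis)"
  proof (rule inj_onI, clarify)
    fix j e k d assume *: "g (j, e) = g (k, d)" "j \<in> J" "e \<in> Basis" "d \<in> Basis"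
    have "g (j, e) \<bullet> g (k, d) \<noteq> 0"
      unfolding *(1)[symmetric] using nz[OF *(2,3)] by simp
    then show "j = k \<and> e = d"
      using orth[of j e k d] *(3,4) by blast
  qed
  then have card: "card V = card J * CARD('d)"
    by (simp add: V_def card_image card_cartesian_product)
  have "pairwise orthogonal V"
    unfolding pairwise_def orthogonal_def V_def
  proof (intro ballI impI)
    fix x y assume "x \<in> g ` (J \<times> Basis)" "y \<in> g ` (J \<times> Basis)" "x \<noteq> y"
    then obtain j e k d where "x = g (j, e)" "y = g (k, d)" "(j, e) \<noteq> (k, d)" "e \<in> Basis" "d \<in> Basis"
      by auto
    then show "x \<bullet> y = 0"
      using orth by simp
  qed
  moreover have "0 \<notin> V"
    using nz by (auto simp: V_def)
  ultimately have "independent V"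
    by (rule pairwise_orthogonal_independent)
  then have dim_V: "dim (span V) = card J * CARD('d)"
    using card by (simp add: dim_eq_card_independent)
  have "{B. \<forall>j\<in>J. (\<Sum>i\<in>\<sigma> -` {j}. v $ i *\<^sub>R B $ i) = 0} = {B \<in> UNIV. \<forall>x\<in>span V. orthogonal x B}"
  proof -
    have "(\<forall>x\<in>span V. orthogonal x B) \<longleftrightarrow> (\<forall>x\<in>V. orthogonal x B)" for B
      unfolding orthogonal_commute[of _ B] using orthogonal_to_span[of _ V B] span_base[of _ V] by blast
    moreover have "(\<forall>x\<in>V. orthogonal x B) \<longleftrightarrow> (\<forall>j\<in>J. (\<Sum>i\<in>\<sigma> -` {j}. v $ i *\<^sub>R B $ i) = 0)" for B
    proof -
      have "(\<forall>x\<in>V. orthogonal x B) \<longleftrightarrow> (\<forall>j\<in>J. \<forall>e\<in>Basis. g (j, e) \<bullet> B = 0)"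
        by (auto simp: V_def orthogonal_def)
      moreover have "(\<forall>e\<in>Basis. e \<bullet> s = 0) \<longleftrightarrow> s = 0" for s :: "real ^ 'd"
        using euclidean_all_zero_iff[of s] unfolding inner_commute[of s] .
      ultimately show ?thesis
        unfolding inner_g by blast
    qed
    ultimately show ?thesis
      by simp
  qed
  moreover have "dim {B \<in> UNIV. \<forall>x\<in>span V. orthogonal x B} + dim (span V)
      = dim (UNIV :: ((real ^ 'd) ^ 'n) set)"
    by (rule dim_subspace_orthogonal_to_vectors) auto
  moreover have "dim (UNIV :: ((real ^ 'd) ^ 'n) set) = CARD('n) * CARD('d)"
    by simp
  ultimately show ?thesis
    unfolding dim_V by (simp add: diff_mult_distrib2 mult.commute)
qed

section \<open>Convexity and compactness of \<open>C_set\<close>\<close>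

locale barycenter_problem = hyperplane_null_measure \<rho>
  for \<rho> :: "(real ^ 'd) measure" +
  fixes v :: "real ^ 'n"
  assumes v_pos: "v $ i > 0" and v_sum: "(\<Sum>i\<in>UNIV. v $ i) = measure \<rho> UNIV"
begin

lemma v_ge_0: "0 \<le> v $ i"
  using v_pos by (rule less_imp_le)

lemma mem_C_set: "B \<in> C_set v \<rho> \<longleftrightarrow> dominated_by UNIV (($) v) (($) B) \<rho>"
  unfolding C_set_def using weighted_diracs_convex_order_iff[of UNIV "($) v" "($) B"] v_ge_0
  by simp

lemma convex_C_set: "convex (C_set v \<rho>)"
proof (rule convexI)
  fix A B and s t :: real
  assume A: "A \<in> C_set v \<rho>" and B: "B \<in> C_set v \<rho>" and st: "0 \<le> s" "0 \<le> t" "s + t = 1"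
  show "s *\<^sub>R A + t *\<^sub>R B \<in> C_set v \<rho>"
    unfolding mem_C_set dominated_by_def
  proof (intro allI impI)
    fix \<psi> :: "real ^ 'd \<Rightarrow> real" assume \<psi>: "lin_growth_convex \<psi>"
    have "(\<Sum>i\<in>UNIV. v $ i * \<psi> ((s *\<^sub>R A + t *\<^sub>R B) $ i))
        \<le> (\<Sum>i\<in>UNIV. v $ i * (s * \<psi> (A $ i) + t * \<psi> (B $ i)))"
    proof (intro sum_mono mult_left_mono)
      show "\<psi> ((s *\<^sub>R A + t *\<^sub>R B) $ i) \<le> s * \<psi> (A $ i) + t * \<psi> (B $ i)" for i
        using \<psi> st unfolding lin_growth_convex_def convex_on_def by simp
    qed (rule v_ge_0)
    also have "\<dots> = s * (\<Sum>i\<in>UNIV. v $ i * \<psi> (A $ i)) + t * (\<Sum>i\<in>UNIV. v $ i * \<psi> (B $ i))"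
      unfolding sum_distrib_left sum.distrib[symmetric] by (intro sum.cong) (auto simp: algebra_simps)
    also have "\<dots> \<le> s * (\<integral>x. \<psi> x \<partial>\<rho>) + t * (\<integral>x. \<psi> x \<partial>\<rho>)"
      using A B st dominated_byD[OF _ \<psi>] unfolding mem_C_set
      by (intro add_mono mult_left_mono) auto
    also have "\<dots> = (\<integral>x. \<psi> x \<partial>\<rho>)"
      using st by (simp flip: distrib_right)
    finally show "(\<Sum>i\<in>UNIV. v $ i * \<psi> ((s *\<^sub>R A + t *\<^sub>R B) $ i)) \<le> (\<integral>x. \<psi> x \<partial>\<rho>)" .
  qed
qed

text \<open>Testing with the norm bounds every coordinate, since each \<open>v $ i\<close> is
  positive. Each test function contributes a closed condition because finite convex functions are
  continuous.\<close>

lemma compact_C_set: "compact (C_set v \<rho>)"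
  unfolding compact_eq_bounded_closed
proof
  define R where "R = (\<Sum>i\<in>UNIV. (\<integral>x. norm x \<partial>\<rho>) / v $ i)"
  have norm_conv: "lin_growth_convex (norm :: real ^ 'd \<Rightarrow> real)"
    by (rule lin_growth_convexI[where A=1]) (use convex_on_dist[of UNIV 0] in auto)
  have "norm B \<le> R" if "B \<in> C_set v \<rho>" for B
  proof -
    have "norm B \<le> (\<Sum>i\<in>UNIV. norm (B $ i))"
      unfolding norm_vec_def by (rule L2_set_le_sum) simp
    also have "\<dots> \<le> R"
      unfolding R_def
    proof (rule sum_mono)
      fix i
      have "v $ i * norm (B $ i) \<le> (\<Sum>k\<in>UNIV. v $ k * norm (B $ k))"
        by (rule member_le_sum) (auto simp: v_ge_0)
      also have "\<dots> \<le> (\<integral>x. norm x \<partial>\<rho>)"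
        using that norm_conv dominated_byD unfolding mem_C_set by blast
      finally show "norm (B $ i) \<le> (\<integral>x. norm x \<partial>\<rho>) / v $ i"
        using v_pos[of i] by (simp add: field_simps)
    qed
    finally show ?thesis .
  qed
  then show "bounded (C_set v \<rho>)"
    by (auto simp: bounded_iff)
  have "C_set v \<rho> = (\<Inter>\<psi>\<in>Collect lin_growth_convex.
      {B. (\<Sum>i\<in>UNIV. v $ i * \<psi> (B $ i)) \<le> (\<integral>x. \<psi> x \<partial>\<rho>)})"
    by (auto simp: mem_C_set dominated_by_def)
  moreover have "closed {B. (\<Sum>i\<in>UNIV. v $ i * \<psi> (B $ i)) \<le> (\<integral>x. \<psi> x \<partial>\<rho>)}"
    if "lin_growth_convex \<psi>" for \<psi> :: "real ^ 'd \<Rightarrow> real"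
  proof -
    have "continuous_on UNIV \<psi>"
      using that convex_on_continuous unfolding lin_growth_convex_def by blast
    then have "continuous_on UNIV (\<lambda>B :: (real ^ 'd) ^ 'n. \<psi> (B $ i))" for i
      by (rule continuous_on_compose2) (auto intro!: continuous_intros)
    then show ?thesis
      by (intro closed_Collect_le continuous_intros)
  qed
  ultimately show "closed (C_set v \<rho>)"
    by auto
qed

end

section \<open>A single exposed face with fixed weights\<close>

locale laguerre_face = barycenter_problem \<rho> v
  for \<rho> :: "(real ^ 'd) measure" and v :: "real ^ 'n" +
  fixes J :: "'j set" and Y :: "'j \<Rightarrow> real ^ 'd" and \<phi> :: "'j \<Rightarrow> real" and \<sigma> :: "'n \<Rightarrow> 'j"
  assumes generators: "inj_on Y J" and surj_\<sigma>: "range \<sigma> = J"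
    and cell_volume: "j \<in> J \<Longrightarrow> measure \<rho> (laguerre_cell J \<phi> Y j) = (\<Sum>i\<in>\<sigma> -` {j}. v $ i)"
begin

sublocale laguerre_assignment \<rho> J Y \<phi> UNIV "($) v" \<sigma>
proof
  show "finite J" "J \<noteq> {}"
    unfolding surj_\<sigma>[symmetric] by auto
qed (use v_ge_0 generators surj_\<sigma> cell_volume in \<open>auto simp: vimage_def\<close>)

definition face :: "((real ^ 'd) ^ 'n) set" where
  "face = {B. \<forall>j\<in>J. dominated_by (\<sigma> -` {j}) (($) v) (($) B) (measure_restr \<rho> (L j))}"

text \<open>The factor \<open>v $ i\<close> makes the Euclidean inner product with this vector equal
  to the weighted linear form.\<close>

definition normal :: "(real ^ 'd) ^ 'n" where
  "normal = (\<chi> i. v $ i *\<^sub>R Y (\<sigma> i))"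

text \<open>All indices of a class sit at the barycenter of their cell; this point will lie in the
  relative interior of the face.\<close>

definition center :: "(real ^ 'd) ^ 'n" where
  "center = (\<chi> i. (1 / measure \<rho> (L (\<sigma> i))) *\<^sub>R (LINT x:L (\<sigma> i)|\<rho>. x))"

lemma normal_inner: "normal \<bullet> B = (\<Sum>i\<in>UNIV. v $ i * (B $ i \<bullet> Y (\<sigma> i)))"
  unfolding inner_vec_def[of normal B]
  by (intro sum.cong) (simp_all add: normal_def inner_commute[of "B $ _"])

lemma face_eq: "face = C_set v \<rho> \<inter> {B. normal \<bullet> B = max_form}"
proof (rule set_eqI)
  show "B \<in> face \<longleftrightarrow> B \<in> C_set v \<rho> \<inter> {B. normal \<bullet> B = max_form}" for B
    using maximizer_iff_restricted_domination[of "($) B"]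
    by (simp add: face_def mem_C_set normal_inner vimage_def)
qed

lemma normal_le: "B \<in> C_set v \<rho> \<Longrightarrow> normal \<bullet> B \<le> max_form"
  unfolding mem_C_set normal_inner by (rule linear_form_le)

lemma face_exposed: "face exposed_face_of C_set v \<rho>"
  unfolding face_eq using convex_C_set normal_le by (rule exposed_face_of_Int_supporting_hyperplane_le)

lemma cell_mass_pos: "j \<in> J \<Longrightarrow> measure \<rho> (L j) > 0"
  using v_pos surj_\<sigma> by (subst cell_volume) (auto intro!: sum_pos)

lemma mass_restr_cell: "measure (measure_restr \<rho> (L j)) UNIV = measure \<rho> (L j)"
  by (rule measure_measure_restr) simp

lemma ident_restr_cell: "(\<integral>x. x \<partial>measure_restr \<rho> (L j)) = (LINT x:L j|\<rho>. x)"
  by (rule integral_measure_restr) auto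

lemma scaled_center: "\<sigma> i = j \<Longrightarrow> measure \<rho> (L j) *\<^sub>R center $ i = (LINT x:L j|\<rho>. x)"
  using cell_mass_pos[of j] surj_\<sigma> rangeI[of \<sigma> i] by (simp add: center_def)

lemma center_in_face: "center \<in> face"
  unfolding face_def
proof safe
  fix j assume j: "j \<in> J"
  interpret R: first_moment_measure "measure_restr \<rho> (L j)"
    by (rule first_moment_measure_restr) simp
  obtain k where k: "\<sigma> k = j"
    using j surj_\<sigma> by blast
  show "dominated_by (\<sigma> -` {j}) (($) v) (($) center) (measure_restr \<rho> (L j))"
  proof (rule R.dominated_by_if_barycenter)
    show "(\<Sum>i\<in>\<sigma> -` {j}. v $ i) = measure (measure_restr \<rho> (L j)) UNIV"
      using cell_volume[OF j] by (simp add: mass_restr_cell)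
    show "measure (measure_restr \<rho> (L j)) UNIV *\<^sub>R center $ k = (\<integral>x. x \<partial>measure_restr \<rho> (L j))"
      using scaled_center[OF k] by (simp add: mass_restr_cell ident_restr_cell)
    show "center $ i = center $ k" if "i \<in> \<sigma> -` {j}" for i
      using that k by (simp add: center_def)
  qed
qed

lemma face_barycenter:
  assumes "B \<in> face" "j \<in> J"
  shows "(\<Sum>i\<in>\<sigma> -` {j}. v $ i *\<^sub>R B $ i) = (LINT x:L j|\<rho>. x)"
proof -
  interpret R: first_moment_measure "measure_restr \<rho> (L j)"
    by (rule first_moment_measure_restr) simp
  show ?thesis
    using assms R.dominated_by_barycenter unfolding face_def ident_restr_cell[symmetric] by blast
qed

lemma face_near_center:
  "\<exists>\<epsilon>>0. \<forall>B. norm (B - center) \<le> \<epsilon> \<longrightarrow>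
    (\<forall>j\<in>J. (\<Sum>i\<in>\<sigma> -` {j}. v $ i *\<^sub>R B $ i) = (LINT x:L j|\<rho>. x)) \<longrightarrow> B \<in> face"
proof -
  let ?P = "\<lambda>j \<epsilon>. \<epsilon> > 0 \<and> (\<forall>B. norm (B - center) \<le> \<epsilon> \<longrightarrow>
    (\<Sum>i\<in>\<sigma> -` {j}. v $ i *\<^sub>R B $ i) = (LINT x:L j|\<rho>. x) \<longrightarrow>
    dominated_by (\<sigma> -` {j}) (($) v) (($) B) (measure_restr \<rho> (L j)))"
  have ex: "\<exists>\<epsilon>. ?P j \<epsilon>" if j: "j \<in> J" for j
  proof -
    interpret R: hyperplane_null_measure "measure_restr \<rho> (L j)"
      by (rule hyperplane_null_measure_restr) simp
    obtain k where k: "\<sigma> k = j"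
      using j surj_\<sigma> by blast
    have mass: "measure (measure_restr \<rho> (L j)) UNIV > 0"
      using cell_mass_pos[OF j] by (simp add: mass_restr_cell)
    have c: "measure (measure_restr \<rho> (L j)) UNIV *\<^sub>R center $ k = (\<integral>x. x \<partial>measure_restr \<rho> (L j))"
      using scaled_center[OF k] by (simp add: mass_restr_cell ident_restr_cell)
    obtain \<epsilon> where \<epsilon>: "\<epsilon> > 0"
      and dom: "\<And>(I :: 'n set) v b. (\<And>i. i \<in> I \<Longrightarrow> 0 \<le> v i) \<Longrightarrow>
        (\<Sum>i\<in>I. v i) = measure (measure_restr \<rho> (L j)) UNIV \<Longrightarrow>
        (\<Sum>i\<in>I. v i *\<^sub>R b i) = (\<integral>x. x \<partial>measure_restr \<rho> (L j)) \<Longrightarrow>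
        (\<And>i. i \<in> I \<Longrightarrow> norm (b i - center $ k) \<le> \<epsilon>) \<Longrightarrow> dominated_by I v b (measure_restr \<rho> (L j))"
      using R.dominated_by_near_barycenter[OF mass c] by blast
    have "dominated_by (\<sigma> -` {j}) (($) v) (($) B) (measure_restr \<rho> (L j))"
      if B: "norm (B - center) \<le> \<epsilon>" "(\<Sum>i\<in>\<sigma> -` {j}. v $ i *\<^sub>R B $ i) = (LINT x:L j|\<rho>. x)" for B
    proof (rule dom)
      show "0 \<le> v $ i" for i
        by (rule v_ge_0)
      show "(\<Sum>i\<in>\<sigma> -` {j}. v $ i) = measure (measure_restr \<rho> (L j)) UNIV"
        using cell_volume[OF j] by (simp add: mass_restr_cell)
      show "(\<Sum>i\<in>\<sigma> -` {j}. v $ i *\<^sub>R B $ i) = (\<integral>x. x \<partial>measure_restr \<rho> (L j))"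
        using B(2) by (simp add: ident_restr_cell)
      fix i assume "i \<in> \<sigma> -` {j}"
      then have "B $ i - center $ k = (B - center) $ i"
        using k by (simp add: center_def)
      also have "norm \<dots> \<le> \<epsilon>"
        using Finite_Cartesian_Product.norm_nth_le B(1) by (rule order_trans)
      finally show "norm (B $ i - center $ k) \<le> \<epsilon>" .
    qed
    with \<epsilon> show ?thesis
      by blast
  qed
  \<comment> \<open>The radius obtained above depends on the cell. There are finitely many cells, so
    the smallest radius works for all.\<close>
  define e where "e j = (SOME \<epsilon>. ?P j \<epsilon>)" for j
  have e: "?P j (e j)" if "j \<in> J" for j
    unfolding e_def by (rule someI_ex[OF ex[OF that]])
  define \<epsilon> where "\<epsilon> = (MIN j\<in>J. e j)"
  have "\<epsilon> > 0"
    using e finite_J J_nonempty by (simp add: \<epsilon>_def)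
  moreover have "B \<in> face" if "norm (B - center) \<le> \<epsilon>"
    "\<forall>j\<in>J. (\<Sum>i\<in>\<sigma> -` {j}. v $ i *\<^sub>R B $ i) = (LINT x:L j|\<rho>. x)" for B
    unfolding face_def
  proof safe
    fix j assume j: "j \<in> J"
    have "\<epsilon> \<le> e j"
      using finite_J j by (simp add: \<epsilon>_def)
    then show "dominated_by (\<sigma> -` {j}) (($) v) (($) B) (measure_restr \<rho> (L j))"
      using that(1) e[OF j] bspec[OF that(2) j] by (meson order_trans)
  qed
  ultimately show ?thesis
    by blast
qed

text \<open>The face lies in the affine space \<open>A\<close> of the barycenter constraints and
  contains a ball of \<open>A\<close> around \<open>center\<close>, so the two have the same affine
  hull dimension.\<close>

lemma aff_dim_face: "aff_dim face = int (CARD('d) * (CARD('n) - card J))"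
proof -
  define A where "A = {B :: (real ^ 'd) ^ 'n. \<forall>j\<in>J. (\<Sum>i\<in>\<sigma> -` {j}. v $ i *\<^sub>R B $ i) = (LINT x:L j|\<rho>. x)}"
  define S where "S = {B :: (real ^ 'd) ^ 'n. \<forall>j\<in>J. (\<Sum>i\<in>\<sigma> -` {j}. v $ i *\<^sub>R B $ i) = 0}"
  have "subspace S"
    unfolding S_def subspace_def
    by (auto simp: scaleR_add_right sum.distrib scaleR_left_commute[of "v $ _"]
        simp del: scaleR_scaleR simp flip: scaleR_sum_right)
  have sub: "face \<subseteq> A"
    using face_barycenter by (auto simp: A_def)
  have "A = (+) center ` S"
  proof -
    have "B \<in> A \<longleftrightarrow> B - center \<in> S" for B
      using center_in_face face_barycenter
      by (auto simp: A_def S_def scaleR_diff_right sum_subtractf)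
    then show ?thesis
      by (force simp: image_iff algebra_simps)
  qed
  then have A: "convex A" "aff_dim A = int (dim S)"
    using \<open>subspace S\<close> by (simp_all add: aff_dim_translation_eq aff_dim_subspace
        convex_translation subspace_imp_convex)
  obtain \<epsilon> where "\<epsilon> > 0" and near: "\<forall>B. norm (B - center) \<le> \<epsilon> \<longrightarrow>
      (\<forall>j\<in>J. (\<Sum>i\<in>\<sigma> -` {j}. v $ i *\<^sub>R B $ i) = (LINT x:L j|\<rho>. x)) \<longrightarrow> B \<in> face"
    using face_near_center by blast
  have "A \<inter> ball center \<epsilon> \<subseteq> face"
  proof
    fix B assume "B \<in> A \<inter> ball center \<epsilon>"
    then show "B \<in> face"
      by (intro near[rule_format]) (auto simp: A_def dist_norm norm_minus_commute)
  qed
  moreover have "center \<in> A \<inter> ball center \<epsilon>"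
    using sub center_in_face \<open>\<epsilon> > 0\<close> by auto
  then have "aff_dim (A \<inter> ball center \<epsilon>) = aff_dim A"
    using A(1) by (intro aff_dim_convex_Int_open) auto
  ultimately have "aff_dim face = aff_dim A"
    using aff_dim_subset[OF sub] aff_dim_subset[of "A \<inter> ball center \<epsilon>" face] by simp
  then show ?thesis
    using A(2) dim_weighted_class_sums_zero[where 'd='d, OF v_pos surj_\<sigma>] by (simp add: S_def)
qed

end

section \<open>Exposed faces and relative boundary in terms of \<open>F_Lag\<close>\<close>

context barycenter_problem
begin

lemma F_Lag_eq_face:
  assumes Y: "inj_on Y {1..M}" and \<sigma>: "range \<sigma> = {1..M}"
  obtains \<phi> where "laguerre_face \<rho> v {1..M} Y \<phi> \<sigma>"
    "F_Lag v \<rho> M Y \<sigma> = laguerre_face.face \<rho> v {1..M} Y \<phi> \<sigma>"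
proof -
  define w where "w k = (\<Sum>i\<in>\<sigma> -` {k}. v $ i)" for k
  \<comment> \<open>The same choice as in \<open>laguerre_star\<close>, so the cells agree as sets
    and not just up to null sets.\<close>
  define \<phi> where "\<phi> = (SOME \<phi>. \<forall>j\<in>{1..M}. measure \<rho> (laguerre_cell {1..M} \<phi> Y j) = w j)"
  have ne: "{1..M} \<noteq> {}"
    unfolding \<sigma>[symmetric] by simp
  have w_pos: "w k > 0" if "k \<in> {1..M}" for k
  proof -
    have "\<sigma> -` {k} \<noteq> {}"
      using that unfolding \<sigma>[symmetric] by auto
    then show ?thesis
      unfolding w_def using v_pos by (intro sum_pos) auto
  qed
  have "(\<Sum>k\<in>{1..M}. w k) = (\<Sum>i\<in>UNIV. v $ i)"
    using sum.group[of UNIV "{1..M}" \<sigma> "($) v"] \<sigma> by (simp add: w_def vimage_def)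
  then have "\<exists>\<phi>. \<forall>j\<in>{1..M}. measure \<rho> (laguerre_cell {1..M} \<phi> Y j) = w j"
    using w_pos ne Y v_sum by (intro exists_laguerre_weights) auto
  then have \<phi>: "\<forall>j\<in>{1..M}. measure \<rho> (laguerre_cell {1..M} \<phi> Y j) = w j"
    unfolding \<phi>_def by (rule someI_ex)
  interpret G: laguerre_face \<rho> v "{1..M}" Y \<phi> \<sigma>
    by unfold_locales (use Y \<sigma> \<phi> in \<open>auto simp: w_def\<close>)
  have "weighted_diracs (\<sigma> -` {j}) (($) v) (($) B) \<preceq>\<^sub>C measure_restr \<rho> (G.L j) \<longleftrightarrow>
      dominated_by (\<sigma> -` {j}) (($) v) (($) B) (measure_restr \<rho> (G.L j))" for j B
  proof -
    interpret R: first_moment_measure "measure_restr \<rho> (G.L j)"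
      by (rule first_moment_measure_restr) simp
    show ?thesis
      by (rule R.weighted_diracs_convex_order_iff) (auto simp: v_ge_0)
  qed
  moreover have "laguerre_star \<rho> {1..M} (\<lambda>k. \<Sum>i\<in>\<sigma> -` {k}. v $ i) Y = G.L"
    unfolding laguerre_star_def \<phi>_def w_def by (rule ext) simp
  ultimately have "F_Lag v \<rho> M Y \<sigma> = G.face"
    unfolding F_Lag_def G.face_def by simp
  with G.laguerre_face_axioms show thesis
    by (rule that)
qed

lemma F_Lag_exposed_face:
  assumes "inj_on Y {1..M}" "range \<sigma> = {1..M}"
  shows "F_Lag v \<rho> M Y \<sigma> exposed_face_of C_set v \<rho>"
    and "aff_dim (F_Lag v \<rho> M Y \<sigma>) = int (CARD('d) * (CARD('n) - M))"
    and "F_Lag v \<rho> M Y \<sigma> \<noteq> {}"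
    and "\<exists>m. F_Lag v \<rho> M Y \<sigma> = C_set v \<rho> \<inter> {B. (\<chi> i. v $ i *\<^sub>R Y (\<sigma> i)) \<bullet> B = m} \<and>
      (\<forall>B\<in>C_set v \<rho>. (\<chi> i. v $ i *\<^sub>R Y (\<sigma> i)) \<bullet> B \<le> m)"
proof -
  obtain \<phi> where lf: "laguerre_face \<rho> v {1..M} Y \<phi> \<sigma>"
    and eq: "F_Lag v \<rho> M Y \<sigma> = laguerre_face.face \<rho> v {1..M} Y \<phi> \<sigma>"
    using assms by (rule F_Lag_eq_face)
  interpret G: laguerre_face \<rho> v "{1..M}" Y \<phi> \<sigma>
    by (rule lf)
  show "F_Lag v \<rho> M Y \<sigma> exposed_face_of C_set v \<rho>"
    unfolding eq by (rule G.face_exposed)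
  show "aff_dim (F_Lag v \<rho> M Y \<sigma>) = int (CARD('d) * (CARD('n) - M))"
    unfolding eq G.aff_dim_face by simp
  show "F_Lag v \<rho> M Y \<sigma> \<noteq> {}"
    using G.center_in_face unfolding eq by blast
  show "\<exists>m. F_Lag v \<rho> M Y \<sigma> = C_set v \<rho> \<inter> {B. (\<chi> i. v $ i *\<^sub>R Y (\<sigma> i)) \<bullet> B = m} \<and>
      (\<forall>B\<in>C_set v \<rho>. (\<chi> i. v $ i *\<^sub>R Y (\<sigma> i)) \<bullet> B \<le> m)"
    unfolding eq G.normal_def[symmetric] using G.face_eq G.normal_le by blast
qed

text \<open>With one generator the form sees only the barycenter of the configuration, which is the
  same throughout \<open>C_set\<close>; hence every point is a maximizer.\<close>

lemma F_Lag_single_cell: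
  assumes "range \<sigma> = {1..1::nat}"
  shows "F_Lag v \<rho> 1 Y \<sigma> = C_set v \<rho>"
proof -
  have *: "inj_on Y {1..1}"
    by simp
  obtain m where m: "F_Lag v \<rho> 1 Y \<sigma> = C_set v \<rho> \<inter> {B. (\<chi> i. v $ i *\<^sub>R Y (\<sigma> i)) \<bullet> B = m}"
    using F_Lag_exposed_face(4)[OF * assms] by blast
  have form: "(\<chi> i. v $ i *\<^sub>R Y (\<sigma> i)) \<bullet> B = Y 1 \<bullet> (\<integral>x. x \<partial>\<rho>)" if "B \<in> C_set v \<rho>" for B
  proof -
    have "\<sigma> i = 1" for i
      using assms rangeI[of \<sigma> i] by simp
    then have "(\<chi> i. v $ i *\<^sub>R Y (\<sigma> i)) \<bullet> B = Y 1 \<bullet> (\<Sum>i\<in>UNIV. v $ i *\<^sub>R B $ i)"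
      unfolding inner_vec_def[of _ B] by (simp add: inner_sum_right)
    then show ?thesis
      using that dominated_by_barycenter[of UNIV "($) v" "($) B"] unfolding mem_C_set by simp
  qed
  obtain A where "A \<in> F_Lag v \<rho> 1 Y \<sigma>"
    using F_Lag_exposed_face(3)[OF * assms] by blast
  then have "m = Y 1 \<bullet> (\<integral>x. x \<partial>\<rho>)"
    using m form[of A] by auto
  then show ?thesis
    using m form by auto
qed

lemma exposed_face_is_F_Lag:
  assumes F: "F exposed_face_of C_set v \<rho>" "F \<noteq> {}"
  obtains M Y \<sigma> where "M \<in> {1..CARD('n)}" "inj_on Y {1..M}" "range \<sigma> = {1..M}" "F = F_Lag v \<rho> M Y \<sigma>"
proof -
  obtain a b where a: "C_set v \<rho> \<subseteq> {B. a \<bullet> B \<le> b}" "F = C_set v \<rho> \<inter> {B. a \<bullet> B = b}"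
    using F(1) unfolding exposed_face_of_def by blast
  \<comment> \<open>Dividing by the weights recovers generators from the coefficients of the form.
    Enumerating their distinct values gives \<open>Y\<close>, and \<open>\<sigma>\<close> records
    which value each index has. The zero form falls under \<open>M = 1\<close>.\<close>
  define y where "y i = (1 / v $ i) *\<^sub>R a $ i" for i
  define M where "M = card (range y)"
  obtain Y where Y: "bij_betw Y {1..M} (range y)"
    unfolding M_def using ex_bij_betw_nat_finite_1[of "range y"] by auto
  define \<sigma> where "\<sigma> i = inv_into {1..M} Y (y i)" for i
  have Y_\<sigma>: "Y (\<sigma> i) = y i" for i
    unfolding \<sigma>_def using Y by (simp add: bij_betw_imp_surj_on f_inv_into_f)
  have "range \<sigma> = inv_into {1..M} Y ` range y"
    by (auto simp: \<sigma>_def)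
  also have "\<dots> = {1..M}"
    using bij_betw_inv_into[OF Y] by (rule bij_betw_imp_surj_on)
  finally have \<sigma>: "range \<sigma> = {1..M}" .
  have inj: "inj_on Y {1..M}"
    using Y by (rule bij_betw_imp_inj_on)
  have "(\<chi> i. v $ i *\<^sub>R Y (\<sigma> i)) = a"
    unfolding Y_\<sigma> y_def vec_eq_iff using v_pos by (simp add: less_imp_neq[symmetric])
  then obtain m where m: "F_Lag v \<rho> M Y \<sigma> = C_set v \<rho> \<inter> {B. a \<bullet> B = m}"
    "\<forall>B\<in>C_set v \<rho>. a \<bullet> B \<le> m"
    using F_Lag_exposed_face(4)[OF inj \<sigma>] by auto
  obtain A B where "A \<in> F_Lag v \<rho> M Y \<sigma>" "B \<in> F"
    using F(2) F_Lag_exposed_face(3)[OF inj \<sigma>] by blast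
  \<comment> \<open>Both \<open>b\<close> and \<open>m\<close> bound the form on
    \<open>C_set\<close> and both are attained, so they coincide.\<close>
  then have "a \<bullet> A = m" "a \<bullet> A \<le> b" "a \<bullet> B = b" "a \<bullet> B \<le> m"
    using a m by auto
  then have "F = F_Lag v \<rho> M Y \<sigma>"
    using a(2) m(1) by simp
  moreover have "M \<in> {1..CARD('n)}"
    using card_image_le[of UNIV y] by (simp add: M_def Suc_le_eq card_gt_0_iff)
  ultimately show thesis
    using that inj \<sigma> by blast
qed

lemma aff_dim_C_set: "aff_dim (C_set v \<rho>) = int (CARD('d) * (CARD('n) - 1))"
proof -
  have \<sigma>: "range (\<lambda>i::'n. 1::nat) = {1..1}"
    by simp
  show ?thesis
    using F_Lag_exposed_face(2)[OF _ \<sigma>, of "\<lambda>_. 0"] F_Lag_single_cell[OF \<sigma>, of "\<lambda>_. 0"] by simp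
qed

text \<open>The dimensions differ: the whole set has the dimension belonging to
  \<open>M = 1\<close>.\<close>

lemma F_Lag_neq_C_set:
  assumes "inj_on Y {1..M}" "range \<sigma> = {1..M}" "M \<in> {2..CARD('n)}"
  shows "F_Lag v \<rho> M Y \<sigma> \<noteq> C_set v \<rho>"
proof
  assume "F_Lag v \<rho> M Y \<sigma> = C_set v \<rho>"
  then have "CARD('d) * (CARD('n) - M) = CARD('d) * (CARD('n) - 1)"
    using F_Lag_exposed_face(2)[OF assms(1,2)] aff_dim_C_set by (metis of_nat_eq_iff)
  then show False
    using assms(3) by auto
qed

lemma proper_exposed_face_is_F_Lag:
  assumes F: "F exposed_face_of C_set v \<rho>" "F \<noteq> {}" "F \<noteq> C_set v \<rho>"
  obtains M Y \<sigma> where "M \<in> {2..CARD('n)}" "inj_on Y {1..M}" "range \<sigma> = {1..M}" "F = F_Lag v \<rho> M Y \<sigma>"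
proof -
  obtain M Y \<sigma> where *: "M \<in> {1..CARD('n)}" "inj_on Y {1..M}" "range \<sigma> = {1..M}" "F = F_Lag v \<rho> M Y \<sigma>"
    using F(1,2) by (rule exposed_face_is_F_Lag)
  then have "M \<noteq> 1"
    using F_Lag_single_cell F(3) by blast
  then show thesis
    using * by (intro that) auto
qed

text \<open>As \<open>CARD('d)\<close> is positive, the dimension of a nonempty exposed face
  determines its number of cells.\<close>

lemma exposed_faces_of_given_dim:
  assumes M: "M \<in> {2..CARD('n)}"
  shows "{F. F exposed_face_of C_set v \<rho> \<and> aff_dim F = int (CARD('d) * (CARD('n) - M))} =
    {F_Lag v \<rho> M Y \<sigma> | Y \<sigma>. inj_on Y {1..M} \<and> range \<sigma> = {1..M}}" (is "?L = ?R")
proof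
  show "?L \<subseteq> ?R"
  proof
    fix F assume F: "F \<in> ?L"
    then have "0 \<le> aff_dim F"
      by simp
    then have "F \<noteq> {}"
      by auto
    moreover have "F exposed_face_of C_set v \<rho>"
      using F by simp
    ultimately obtain M' Y \<sigma> where *: "M' \<in> {1..CARD('n)}" "inj_on Y {1..M'}" "range \<sigma> = {1..M'}"
      "F = F_Lag v \<rho> M' Y \<sigma>"
      using exposed_face_is_F_Lag by metis
    then have "int (CARD('d) * (CARD('n) - M)) = int (CARD('d) * (CARD('n) - M'))"
      using F F_Lag_exposed_face(2)[OF *(2,3)] by simp
    then have "CARD('d) * (CARD('n) - M) = CARD('d) * (CARD('n) - M')"
      by (simp only: of_nat_eq_iff)
    then have "M' = M"
      using M *(1) by auto
    with * show "F \<in> ?R"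
      by blast
  qed
  show "?R \<subseteq> ?L"
    using F_Lag_exposed_face(1,2) by blast
qed

lemma rel_frontier_C_set:
  "rel_frontier (C_set v \<rho>) = \<Union> {F_Lag v \<rho> M Y \<sigma> | M Y \<sigma>.
    M \<in> {2..CARD('n)} \<and> inj_on Y {1..M} \<and> range \<sigma> = {1..M}}" (is "_ = \<Union> ?R")
proof
  show "\<Union> ?R \<subseteq> rel_frontier (C_set v \<rho>)"
  proof (rule Union_least)
    fix F assume "F \<in> ?R"
    then obtain M Y \<sigma> where *: "F = F_Lag v \<rho> M Y \<sigma>" "M \<in> {2..CARD('n)}" "inj_on Y {1..M}" "range \<sigma> = {1..M}"
      by blast
    then have "F face_of C_set v \<rho>" "F \<noteq> C_set v \<rho>"
      using F_Lag_exposed_face(1) F_Lag_neq_C_set unfolding exposed_face_of_def by blast+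
    then show "F \<subseteq> rel_frontier (C_set v \<rho>)"
      by (rule face_of_subset_rel_frontier)
  qed
  show "rel_frontier (C_set v \<rho>) \<subseteq> \<Union> ?R"
  proof
    fix B assume "B \<in> rel_frontier (C_set v \<rho>)"
    then have B: "B \<in> C_set v \<rho>" "B \<notin> rel_interior (C_set v \<rho>)"
      using compact_imp_closed[OF compact_C_set] by (auto simp: rel_frontier_def closure_closed)
    \<comment> \<open>The hyperplane is strict on the relative interior, which is nonempty; a point
      there shows that the exposed face is proper.\<close>
    obtain a where a: "\<And>A. A \<in> C_set v \<rho> \<Longrightarrow> a \<bullet> B \<le> a \<bullet> A"
      "\<And>A. A \<in> rel_interior (C_set v \<rho>) \<Longrightarrow> a \<bullet> B < a \<bullet> A"
      using supporting_hyperplane_rel_boundary[OF convex_C_set B] by metis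
    let ?F = "C_set v \<rho> \<inter> {A. a \<bullet> A = a \<bullet> B}"
    have exposed: "?F exposed_face_of C_set v \<rho>"
      using convex_C_set a(1) by (rule exposed_face_of_Int_supporting_hyperplane_ge)
    have BF: "B \<in> ?F"
      using B by simp
    obtain A where "A \<in> rel_interior (C_set v \<rho>)"
      using B(1) convex_C_set rel_interior_eq_empty by blast
    then have "A \<in> C_set v \<rho>" "a \<bullet> B < a \<bullet> A"
      using a(2) rel_interior_subset by blast+
    then have "A \<notin> ?F"
      by simp
    then have "?F \<noteq> C_set v \<rho>"
      using \<open>A \<in> C_set v \<rho>\<close> by blast
    moreover have "?F \<noteq> {}"
      using BF by blast
    ultimately obtain M Y \<sigma> where "M \<in> {2..CARD('n)}" "inj_on Y {1..M}" "range \<sigma> = {1..M}" "?F = F_Lag v \<rho> M Y \<sigma>"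
      using proper_exposed_face_is_F_Lag[OF exposed] by metis
    with BF show "B \<in> \<Union> ?R"
      by blast
  qed
qed

section \<open>Laguerre barycenters as zero-dimensional faces\<close>

lemma mem_B_Lag:
  "B \<in> B_Lag v \<rho> \<longleftrightarrow>
    (\<exists>Y \<phi>. laguerre_face \<rho> v UNIV Y \<phi> id \<and> B = laguerre_face.center \<rho> UNIV Y \<phi> id)"
proof -
  have face: "laguerre_face \<rho> v UNIV Y \<phi> id \<longleftrightarrow>
      inj Y \<and> (\<forall>i. measure \<rho> (laguerre_cell UNIV \<phi> Y i) = v $ i)" for Y \<phi>
    using barycenter_problem_axioms by (auto simp: laguerre_face_def laguerre_face_axioms_def)
  have center: "laguerre_face.center \<rho> UNIV Y \<phi> id =
      (\<chi> i. (1 / v $ i) *\<^sub>R (LINT x:laguerre_cell UNIV \<phi> Y i|\<rho>. x))"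
    if "laguerre_face \<rho> v UNIV Y \<phi> id" for Y \<phi>
    using that face unfolding laguerre_face.center_def[OF that] by simp
  show ?thesis
  proof
    assume "B \<in> B_Lag v \<rho>"
    then obtain Y \<phi> where "inj Y" and *: "\<forall>i. measure \<rho> (laguerre_cell UNIV \<phi> Y i) = v $ i \<and>
        B $ i = (1 / v $ i) *\<^sub>R (LINT x:laguerre_cell UNIV \<phi> Y i|\<rho>. x)"
      unfolding B_Lag_def by blast
    then have "laguerre_face \<rho> v UNIV Y \<phi> id"
      unfolding face by blast
    then show "\<exists>Y \<phi>. laguerre_face \<rho> v UNIV Y \<phi> id \<and> B = laguerre_face.center \<rho> UNIV Y \<phi> id"
      using * center by (intro exI[of _ Y] exI[of _ \<phi>]) (simp add: vec_eq_iff)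
  next
    assume "\<exists>Y \<phi>. laguerre_face \<rho> v UNIV Y \<phi> id \<and> B = laguerre_face.center \<rho> UNIV Y \<phi> id"
    then obtain Y \<phi> where "laguerre_face \<rho> v UNIV Y \<phi> id" "B = laguerre_face.center \<rho> UNIV Y \<phi> id"
      by blast
    then show "B \<in> B_Lag v \<rho>"
      using center[of Y \<phi>] face[of Y \<phi>] unfolding B_Lag_def by auto
  qed
qed

text \<open>A face is a single point exactly when there are as many cells as indices. Then
  \<open>\<sigma>\<close> is a bijection, and relabelling the cells along it gives a tessellation
  indexed by the type \<open>'n\<close> itself.\<close>

lemma B_Lag_eq_exposed_points: "B_Lag v \<rho> = {B. {B} exposed_face_of C_set v \<rho>}"
proof safe
  fix B assume "B \<in> B_Lag v \<rho>"
  then obtain Y \<phi> where lf: "laguerre_face \<rho> v UNIV Y \<phi> id"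
    and B: "B = laguerre_face.center \<rho> UNIV Y \<phi> id"
    unfolding mem_B_Lag by blast
  interpret G: laguerre_face \<rho> v UNIV Y \<phi> id
    by (rule lf)
  have "aff_dim G.face = 0"
    unfolding G.aff_dim_face by simp
  then have "G.face = {B}"
    using G.center_in_face unfolding aff_dim_eq_0 B by auto
  then show "{B} exposed_face_of C_set v \<rho>"
    using G.face_exposed by simp
next
  fix B assume "{B} exposed_face_of C_set v \<rho>"
  then obtain M Y \<sigma> where M: "M \<in> {1..CARD('n)}" and Y: "inj_on Y {1..M}" and \<sigma>: "range \<sigma> = {1..M}"
    and eq: "{B} = F_Lag v \<rho> M Y \<sigma>"
    by (rule exposed_face_is_F_Lag) auto
  have "int (CARD('d) * (CARD('n) - M)) = 0"
    using F_Lag_exposed_face(2)[OF Y \<sigma>] unfolding eq[symmetric] by simp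
  then have "card (range \<sigma>) = CARD('n)"
    using M unfolding \<sigma> by simp
  then have inj_\<sigma>: "inj \<sigma>"
    by (intro eq_card_imp_inj_on) auto
  obtain \<phi> where lf: "laguerre_face \<rho> v {1..M} Y \<phi> \<sigma>"
    and "F_Lag v \<rho> M Y \<sigma> = laguerre_face.face \<rho> v {1..M} Y \<phi> \<sigma>"
    using Y \<sigma> by (rule F_Lag_eq_face)
  interpret G: laguerre_face \<rho> v "{1..M}" Y \<phi> \<sigma>
    by (rule lf)
  have B: "B = G.center"
    using G.center_in_face unfolding \<open>F_Lag v \<rho> M Y \<sigma> = G.face\<close>[symmetric] eq[symmetric] by simp
  have cell: "laguerre_cell UNIV (\<phi> \<circ> \<sigma>) (Y \<circ> \<sigma>) i = G.L (\<sigma> i)" for i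
    unfolding set_eq_iff mem_laguerre_cell \<sigma>[symmetric] by simp
  interpret H: laguerre_face \<rho> v UNIV "Y \<circ> \<sigma>" "\<phi> \<circ> \<sigma>" id
  proof
    show "inj (Y \<circ> \<sigma>)"
      using inj_\<sigma> Y \<sigma> by (intro comp_inj_on) auto
    show "measure \<rho> (laguerre_cell UNIV (\<phi> \<circ> \<sigma>) (Y \<circ> \<sigma>) i) = (\<Sum>k\<in>id -` {i}. v $ k)" for i
    proof -
      have "\<sigma> -` {\<sigma> i} = {i}"
        using inj_\<sigma> by (auto dest: injD)
      then show ?thesis
        using G.cell_volume[of "\<sigma> i"] rangeI[of \<sigma> i] unfolding \<sigma> cell by simp
    qed
  qed simp
  have "B = H.center"
    unfolding B G.center_def H.center_def cell by simp
  then show "B \<in> B_Lag v \<rho>"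
    using H.laguerre_face_axioms unfolding mem_B_Lag by blast
qed

end

section \<open>Generic linear forms and the convex hull\<close>

lemma small_injective_perturbation:
  fixes y z :: "'i::finite \<Rightarrow> 'a::real_vector"
  assumes z: "inj z" and "\<delta> > 0"
  shows "\<exists>t>0. t < \<delta> \<and> inj (\<lambda>i. y i + t *\<^sub>R z i)"
proof -
  let ?bad = "\<lambda>i j. {t. y i + t *\<^sub>R z i = y j + t *\<^sub>R z j}"
  \<comment> \<open>Since \<open>z i \<noteq> z j\<close>, the lines traced by the indices
    \<open>i\<close> and \<open>j\<close> meet for at most one parameter, so only finitely many
    values of \<open>t\<close> must be avoided.\<close>
  have "finite (?bad i j)" if "i \<noteq> j" for i j
  proof -
    have "s = t" if "s \<in> ?bad i j" "t \<in> ?bad i j" for s t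
    proof -
      have "s *\<^sub>R (z i - z j) = y j - y i" "t *\<^sub>R (z i - z j) = y j - y i"
        using that by (auto simp: algebra_simps)
      then have "s *\<^sub>R (z i - z j) = t *\<^sub>R (z i - z j)"
        by simp
      then show ?thesis
        using z \<open>i \<noteq> j\<close> by (auto simp: inj_eq)
    qed
    then have "?bad i j = {} \<or> (\<exists>t. ?bad i j = {t})"
      by blast
    then show ?thesis
      by (elim disjE exE) simp_all
  qed
  then have "finite (\<Union>i. \<Union>j\<in>UNIV - {i}. ?bad i j)"
    by auto
  moreover have "infinite {0<..<\<delta>}"
    using \<open>\<delta> > 0\<close> by simp
  ultimately have "{0<..<\<delta>} - (\<Union>i. \<Union>j\<in>UNIV - {i}. ?bad i j) \<noteq> {}"
    by (intro infinite_imp_nonempty Diff_infinite_finite)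
  then obtain t where "t \<in> {0<..<\<delta>} - (\<Union>i. \<Union>j\<in>UNIV - {i}. ?bad i j)"
    unfolding ex_in_conv[symmetric] by (elim exE)
  then have t: "t \<in> {0<..<\<delta>}" "t \<notin> (\<Union>i. \<Union>j\<in>UNIV - {i}. ?bad i j)"
    by simp_all
  then have "inj (\<lambda>i. y i + t *\<^sub>R z i)"
    by (intro injI) auto
  with t(1) show ?thesis
    by auto
qed

context barycenter_problem
begin

text \<open>A point outside the closed convex hull can be separated from it by a linear form whose
  generators are pairwise distinct, and such a form is maximized at a point of \<open>B_Lag\<close>.\<close>

lemma C_set_eq_convex_hull: "C_set v \<rho> = convex hull (closure (B_Lag v \<rho>))"
proof
  have sub: "B_Lag v \<rho> \<subseteq> C_set v \<rho>"
    unfolding B_Lag_eq_exposed_points exposed_face_of_def using face_of_imp_subset by blast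
  then have "closure (B_Lag v \<rho>) \<subseteq> C_set v \<rho>"
    using compact_C_set by (intro closure_minimal compact_imp_closed)
  then show "convex hull (closure (B_Lag v \<rho>)) \<subseteq> C_set v \<rho>"
    using convex_C_set by (rule hull_minimal)
  show "C_set v \<rho> \<subseteq> convex hull (closure (B_Lag v \<rho>))" (is "_ \<subseteq> ?K")
  proof
    fix B assume B: "B \<in> C_set v \<rho>"
    show "B \<in> ?K"
    proof (rule ccontr)
      assume "B \<notin> ?K"
      have "bounded (B_Lag v \<rho>)"
        using compact_C_set sub by (meson bounded_subset compact_imp_bounded)
      then have "closed ?K"
        by (intro compact_imp_closed compact_convex_hull) (simp add: compact_closure)
      then obtain a b where a: "a \<bullet> B < b" "\<forall>A\<in>?K. b < a \<bullet> A"
        using separating_hyperplane_closed_point[of ?K B] \<open>B \<notin> ?K\<close> by auto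
      \<comment> \<open>Distinct multiples of one unit vector give a direction that separates all
        indices.\<close>
      obtain f :: "'n \<Rightarrow> nat" where f: "inj f"
        using finite_imp_inj_to_nat_seg[of "UNIV :: 'n set"] by auto
      obtain e :: "real ^ 'd" where "norm e = 1"
        using vector_choose_size zero_le_one by blast
      then have z: "inj (\<lambda>i. real (f i) *\<^sub>R e)"
        using f by (auto simp: inj_def)
      define z where "z = (\<chi> i. v $ i *\<^sub>R real (f i) *\<^sub>R e)"
      obtain R where R: "R > 0" "\<And>A. A \<in> C_set v \<rho> \<Longrightarrow> norm A \<le> R"
        using compact_imp_bounded[OF compact_C_set] bounded_pos by metis
      \<comment> \<open>On \<open>C_set\<close> the perturbation \<open>t *\<^sub>R z\<close>
        changes differences of the form by at most \<open>t\<close> times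
        \<open>norm z * (2 * R)\<close>, which must stay below the separation gap. The added 1
        avoids division by zero, as \<open>z\<close> vanishes when there is a single index at
        0.\<close>
      define \<delta> where "\<delta> = (b - a \<bullet> B) / (norm z * (2 * R) + 1)"
      have den: "norm z * (2 * R) + 1 > 0"
        using R(1) by (intro add_nonneg_pos mult_nonneg_nonneg) auto
      then have "\<delta> > 0"
        using a(1) by (simp add: \<delta>_def)
      then obtain t where t: "0 < t" "t < \<delta>"
        and inj: "inj (\<lambda>i. (1 / v $ i) *\<^sub>R (- a $ i) + t *\<^sub>R (real (f i) *\<^sub>R e))"
        using small_injective_perturbation[OF z \<open>\<delta> > 0\<close>, of "\<lambda>i. (1 / v $ i) *\<^sub>R (- a $ i)"] by blast
      \<comment> \<open>The separation places \<open>B\<close> on the low side of \<open>a\<close>,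
        hence \<open>- a\<close> is the form to be maximized.\<close>
      define Y where "Y i = (1 / v $ i) *\<^sub>R (- a $ i) + t *\<^sub>R (real (f i) *\<^sub>R e)" for i
      have "inj Y"
        using inj unfolding Y_def .
      then obtain \<phi> where \<phi>: "\<forall>j\<in>UNIV. measure \<rho> (laguerre_cell UNIV \<phi> Y j) = v $ j"
        using exists_laguerre_weights[of UNIV Y "($) v"] v_pos v_sum by auto
      interpret G: laguerre_face \<rho> v UNIV Y \<phi> id
        by unfold_locales (use \<open>inj Y\<close> \<phi> in auto)
      have "v $ i \<noteq> 0" for i
        using v_pos[of i] by simp
      then have normal: "G.normal = - a + t *\<^sub>R z"
        unfolding G.normal_def Y_def z_def vec_eq_iff by (simp add: field_simps)
      have "G.center \<in> B_Lag v \<rho>"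
        unfolding mem_B_Lag using G.laguerre_face_axioms by blast
      then have center: "G.center \<in> C_set v \<rho>" "G.center \<in> ?K"
        using subsetD[OF sub] hull_inc[OF subsetD[OF closure_subset]] by auto
      have "G.normal \<bullet> B \<le> G.normal \<bullet> G.center"
        using G.normal_le[OF B] G.center_in_face unfolding G.face_eq by simp
      then have "b - a \<bullet> B < t * (z \<bullet> (G.center - B))"
        using a(2) center(2) unfolding normal by (auto simp: inner_add_left inner_diff_right algebra_simps)
      also have "\<dots> \<le> t * (norm z * (2 * R))"
      proof (intro mult_left_mono)
        have "norm (G.center - B) \<le> 2 * R"
          using R(2)[OF B] R(2)[OF center(1)] norm_triangle_ineq4[of G.center B] by linarith
        then show "z \<bullet> (G.center - B) \<le> norm z * (2 * R)"
          using norm_cauchy_schwarz[of z "G.center - B"] mult_left_mono[of _ "2 * R" "norm z"]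
          by (meson norm_ge_zero order_trans)
      qed (use t in simp)
      also have "\<dots> \<le> t * (norm z * (2 * R) + 1)"
        using t by simp
      also have "\<dots> < \<delta> * (norm z * (2 * R) + 1)"
        using t den by simp
      also have "\<dots> = b - a \<bullet> B"
        using den by (simp add: \<delta>_def)
      finally show False
        by simp
    qed
  qed
qed

end

section \<open>From the density assumption to the final statement\<close>

lemma hyperplane_null_measure_if_bounded_density:
  fixes \<rho> :: "'a::euclidean_space measure"
  assumes "borel_finite_first_moment \<rho>" "has_bounded_density \<rho>"
  shows "hyperplane_null_measure \<rho>"
proof -
  interpret first_moment_measure \<rho>
    using assms(1) by (simp add: borel_finite_first_moment_iff)
  obtain f :: "'a \<Rightarrow> real" where f: "f \<in> borel_measurable borel" "\<rho> = density lborel (\<lambda>x. ennreal (f x))"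
    using assms(2) unfolding has_bounded_density_def by blast
  have "absolutely_continuous lborel \<rho>"
    unfolding f(2) using f(1) by (intro absolutely_continuousI_density) auto
  moreover have "{x. x \<bullet> a = c} \<in> null_sets lborel" if "a \<noteq> 0" for a :: 'a and c
  proof -
    \<comment> \<open>Negligibility refers to the completed measure; a hyperplane is closed, so its
      nullity passes to \<open>lborel\<close>.\<close>
    have "{x. a \<bullet> x = c} \<in> null_sets lebesgue"
      using negligible_hyperplane[of a c] that by (simp add: negligible_iff_null_sets)
    then show ?thesis
      using closed_hyperplane[of a c]
      by (simp add: null_sets_completion_iff borel_closed inner_commute[of a])
  qed
  ultimately show ?thesis
    by unfold_locales (auto simp: absolutely_continuous_def)
qed

theorem theorem3p6:
  fixes \<rho> :: "(real ^ 'd) measure" and v :: "real ^ 'n"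
  assumes "\<rho> \<in> P1"
    and "has_bounded_density \<rho>"
    and "\<And>i. v $ i > 0"
    and "(\<Sum>i\<in>UNIV. v $ i) = 1"
  shows "C_set v \<rho> = convex hull (closure (B_Lag v \<rho>)) \<and>
     B_Lag v \<rho> = {B. {B} exposed_face_of C_set v \<rho>} \<and>
     (\<forall>F. F exposed_face_of C_set v \<rho> \<and> F \<noteq> {} \<and> F \<noteq> C_set v \<rho> \<longrightarrow>
           (\<exists>M\<in>{2..CARD('n)}. aff_dim F = int (CARD('d) * (CARD('n) - M)))) \<and>
     (\<forall>M\<in>{2..CARD('n)}.
           {F. F exposed_face_of C_set v \<rho> \<and> aff_dim F = int (CARD('d) * (CARD('n) - M))} =
           {F_Lag v \<rho> M Y \<sigma> | Y \<sigma>. inj_on Y {1..M} \<and> range \<sigma> = {1..M}}) \<and>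
     rel_frontier (C_set v \<rho>) =
           \<Union> {F_Lag v \<rho> M Y \<sigma> | M Y \<sigma>.
               M \<in> {2..CARD('n)} \<and> inj_on Y {1..M} \<and> range \<sigma> = {1..M}}"
proof -
  have \<rho>: "prob_space \<rho>" "borel_finite_first_moment \<rho>"
    using assms(1) by (auto simp: P1_def)
  interpret hyperplane_null_measure \<rho>
    using \<rho>(2) assms(2) by (rule hyperplane_null_measure_if_bounded_density)
  interpret barycenter_problem \<rho> v
    using assms(3,4) prob_space.prob_space[OF \<rho>(1)] by unfold_locales auto
  have "\<exists>M\<in>{2..CARD('n)}. aff_dim F = int (CARD('d) * (CARD('n) - M))"
    if F: "F exposed_face_of C_set v \<rho> \<and> F \<noteq> {} \<and> F \<noteq> C_set v \<rho>" for F
  proof -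
    obtain M Y \<sigma> where M: "M \<in> {2..CARD('n)}" and *: "inj_on Y {1..M}" "range \<sigma> = {1..M}"
      and "F = F_Lag v \<rho> M Y \<sigma>"
      using F proper_exposed_face_is_F_Lag by metis
    then show ?thesis
      using F_Lag_exposed_face(2)[OF *] by blast
  qed
  then show ?thesis
    by (intro conjI ballI allI impI C_set_eq_convex_hull B_Lag_eq_exposed_points
        exposed_faces_of_given_dim rel_frontier_C_set)
qed

end
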